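(* Let $(g_n)_{n=1}^\infty$ be a seminormalized, right dominant Schauder basis (of some Banach space). Let $X$ be a Banach space and let $(R, \|\cdot\|_R)$ be a subsequential space on $X$. If every member of $R$ admits a subsequence dominated by a subsequence of $(g_n)_{n=1}^\infty$, then there exists $C>0$ such that every member of $B_R$ admits a subsequence $C$-dominated by a subsequence of $(g_n)_{n=1}^\infty$.
   Context: Domination: for sequences $(e_n)_{n=1}^\infty$, $(f_n)_{n=1}^\infty$ in possibly different Banach spaces, $(f_n)$ $C$-dominates $(e_n)$ (equivalently, $(e_n)$ is $C$-dominated by $(f_n)$) if $\|\sum_n a_n e_n\|\leqslant C\|\sum_n a_n f_n\|$ for every finitely supported scalar sequence $(a_n)_{n=1}^\infty$; $(f_n)$ dominates $(e_n)$ if it $C$-dominates it for some $C$. Right dominance: a Schauder basis $(g_n)_{n=1}^\infty$ is right dominant if for any sequences $m_1<m_2<\ldots$ and $l_1<l_2<\ldots$ of positive integers with $m_n\leqslant l_n$ for all $n\in\mathbb{N}$, $(g_{m_n})_{n=1}^\infty$ is dominated by $(g_{l_n})_{n=1}^\infty$. Subsequential space: for a Banach space $X$, a subsequential space on $X$ is a (not necessarily closed) linear subspace $R$ of $\ell_\infty(X)$ (the bounded sequences in $X$ with the sup norm) with $c_{00}(X)\subset R$, endowed with a norm $\|\cdot\|_R$ such that, with $B_R$ denoting the closed unit ball of $R$ with respect to $\|\cdot\|_R$: (i) $(R,\|\cdot\|_R)$ is a Banach space; (ii) any subsequence of a member of $B_R$ is a member of $B_R$; (iii) $B_R\subset B_{\ell_\infty(X)}$.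 *)

theory Defs
  imports "HOL-Analysis.Analysis" "HOL-Library.Function_Algebras"
begin

text \<open>
  Both real and complex Banach spaces are covered. The scalar field is a type \<open>'k\<close> of class
  \<open>{real_normed_field, heine_borel}\<close>; up to isometric isomorphism its only instances are
  \<open>real\<close> and \<open>complex\<close>. The library class \<^class>\<open>banach\<close> only knows about real scalars, so
  multiplication by \<open>'k\<close> is an explicit function, extending \<^const>\<open>scaleR\<close>.
  Sequences are indexed from 0.
\<close>

locale banach_over = vector_space smul
  for smul :: "'k::{real_normed_field,heine_borel} \<Rightarrow> 'x::banach \<Rightarrow> 'x" +
  assumes norm_smul: "norm (smul a x) = norm a * norm x"
    and smul_of_real: "smul (of_real r) x = r *\<^sub>R x"

lemma banach_over_scaleR: "banach_over (scaleR :: real \<Rightarrow> 'x::banach \<Rightarrow> 'x)"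
  by unfold_locales (simp_all add: algebra_simps)

lemma banach_over_complex: "banach_over ((*) :: complex \<Rightarrow> complex \<Rightarrow> complex)"
  by unfold_locales (simp_all add: algebra_simps norm_mult scaleR_conv_of_real)

definition schauder_basis ::
  "('k::{real_normed_field,heine_borel} \<Rightarrow> 'e::banach \<Rightarrow> 'e) \<Rightarrow> (nat \<Rightarrow> 'e) \<Rightarrow> bool" where
  "schauder_basis smul g \<longleftrightarrow> (\<forall>x. \<exists>!a. (\<lambda>n. smul (a n) (g n)) sums x)"

definition seminormalized :: "(nat \<Rightarrow> 'e::real_normed_vector) \<Rightarrow> bool" where
  "seminormalized g \<longleftrightarrow> (\<exists>c>0. \<exists>D. \<forall>n. c \<le> norm (g n) \<and> norm (g n) \<le> D)"

definition C_dominates ::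
  "real \<Rightarrow> ('k::{real_normed_field,heine_borel} \<Rightarrow> 'f::banach \<Rightarrow> 'f) \<Rightarrow> (nat \<Rightarrow> 'f)
    \<Rightarrow> ('k \<Rightarrow> 'e::banach \<Rightarrow> 'e) \<Rightarrow> (nat \<Rightarrow> 'e) \<Rightarrow> bool" where
  "C_dominates C smulF f smulE e \<longleftrightarrow>
    (\<forall>a. finite {n. a n \<noteq> 0} \<longrightarrow>
      norm (\<Sum>n | a n \<noteq> 0. smulE (a n) (e n)) \<le> C * norm (\<Sum>n | a n \<noteq> 0. smulF (a n) (f n)))"

definition dominates ::
  "('k::{real_normed_field,heine_borel} \<Rightarrow> 'f::banach \<Rightarrow> 'f) \<Rightarrow> (nat \<Rightarrow> 'f)
    \<Rightarrow> ('k \<Rightarrow> 'e::banach \<Rightarrow> 'e) \<Rightarrow> (nat \<Rightarrow> 'e) \<Rightarrow> bool" where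
  "dominates smulF f smulE e \<longleftrightarrow> (\<exists>C. C_dominates C smulF f smulE e)"

definition right_dominant ::
  "('k::{real_normed_field,heine_borel} \<Rightarrow> 'e::banach \<Rightarrow> 'e) \<Rightarrow> (nat \<Rightarrow> 'e) \<Rightarrow> bool" where
  "right_dominant smul g \<longleftrightarrow>
    (\<forall>m l. strict_mono m \<longrightarrow> strict_mono l \<longrightarrow> (\<forall>n. m n \<le> l n) \<longrightarrow>
      dominates smul (g \<circ> l) smul (g \<circ> m))"

definition ell_infty :: "(nat \<Rightarrow> 'x::real_normed_vector) set" where
  "ell_infty = {x. bounded (range x)}"

definition sup_norm :: "(nat \<Rightarrow> 'x::real_normed_vector) \<Rightarrow> real" where
  "sup_norm x = (SUP n. norm (x n))"

definition c00 :: "(nat \<Rightarrow> 'x::zero) set" where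
  "c00 = {x. finite {n. x n \<noteq> 0}}"

definition unit_ball :: "'v set \<Rightarrow> ('v \<Rightarrow> real) \<Rightarrow> 'v set" where
  "unit_ball R nrm = {x \<in> R. nrm x \<le> 1}"

text \<open>
  \<open>nrm\<close> is a function on all sequences, but only its values on \<open>R\<close> are constrained. The vector
  operations on sequences are the pointwise ones.
\<close>

locale subsequential_space = banach_over smul
  for smul :: "'k::{real_normed_field,heine_borel} \<Rightarrow> 'x::banach \<Rightarrow> 'x" +
  fixes R :: "(nat \<Rightarrow> 'x) set" and nrm :: "(nat \<Rightarrow> 'x) \<Rightarrow> real"
  assumes R_subset: "R \<subseteq> ell_infty"
    and R_subspace: "module.subspace (\<lambda>a x n. smul a (x n)) R"
    and c00_subset: "c00 \<subseteq> R"
    and nrm_nonneg: "x \<in> R \<Longrightarrow> 0 \<le> nrm x"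
    and nrm_eq_0: "x \<in> R \<Longrightarrow> nrm x = 0 \<longleftrightarrow> x = 0"
    and nrm_triangle: "x \<in> R \<Longrightarrow> y \<in> R \<Longrightarrow> nrm (x + y) \<le> nrm x + nrm y"
    and nrm_smul: "x \<in> R \<Longrightarrow> nrm (\<lambda>n. smul a (x n)) = norm a * nrm x"
    and nrm_complete: "range \<xi> \<subseteq> R \<Longrightarrow>
          (\<forall>\<epsilon>>0. \<exists>N. \<forall>i\<ge>N. \<forall>j\<ge>N. nrm (\<xi> i - \<xi> j) < \<epsilon>) \<Longrightarrow>
          \<exists>x\<in>R. (\<lambda>i. nrm (\<xi> i - x)) \<longlonglongrightarrow> 0"
    and ball_subseq: "x \<in> unit_ball R nrm \<Longrightarrow> strict_mono r \<Longrightarrow> x \<circ> r \<in> unit_ball R nrm"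
    and ball_subset: "unit_ball R nrm \<subseteq> unit_ball ell_infty sup_norm"

end

theory Submission
  imports Defs
begin

text \<open>
  Call a sequence hereditarily \<open>C\<close>-dominated if each of its subsequences has a further subsequence
  that is \<open>C\<close>-dominated by a subsequence of \<open>g\<close>. The proof follows the pattern of the open
  mapping theorem, with these sequences in the role of a bounded set.

  Right dominance first upgrades to a uniform statement (\<open>uniform_right_dominance\<close>): one constant
  serves for all pairs of index sequences, since otherwise finite witnesses of failure with worse
  and worse constants could be placed far out and glued to a single pair that violates right
  dominance. Such witnesses exist far out because the basis projections are uniformly bounded
  (\<open>initial_sums_bounded\<close>). Consequently, two dominated sequences can be compared
  with one common subsequence of \<open>g\<close>, and hereditary domination passes to sums and multiples with
  control of the constants.

  A diagonal argument shows that every member of \<open>R\<close> has a hereditarily dominated subsequence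
  (\<open>hereditarily_dominated_subsequence\<close>). A Baire category argument up to subsequences then gives a
  single constant \<open>C\<close> such that every \<open>x\<close> in the unit ball has a subsequence within distance
  \<open>1/2\<close> of a hereditarily \<open>C\<close>-dominated sequence (\<open>uniform_approximation\<close>). Otherwise one adds
  up smaller and smaller multiples of counterexamples, each chosen after the previous partial sum, so
  that no subsequence of the limit is hereditarily \<open>n\<close>-dominated, for any \<open>n\<close>.

  Finally (\<open>uniform_domination\<close>) the approximation is iterated: up to subsequences,
  \<open>x = z\<^sub>0 + z\<^sub>1 / 2 + z\<^sub>2 / 4 + \<dots>\<close> with \<open>C\<close>-dominated \<open>z\<^sub>j\<close>. Along a diagonal subsequence,
  \<open>z\<^sub>j\<close> enters only from position \<open>j\<close> on, and the remainder at position \<open>i\<close> has norm at most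
  \<open>(1/2)\<^sup>i\<close>. The geometric weights make the contributions of the \<open>z\<^sub>j\<close>
  summable, and since tails and coefficients along a subsequence of \<open>g\<close> are controlled by the norm,
  the diagonal subsequence is dominated with a constant that depends only on \<open>C\<close> and \<open>g\<close>.
\<close>

section \<open>Uniform boundedness of the basis projections\<close>

lemma (in banach_over) bounded_bilinear_smul: "bounded_bilinear smul"
proof
  show "smul (r *\<^sub>R a) b = r *\<^sub>R smul a b" "smul a (r *\<^sub>R b) = r *\<^sub>R smul a b" for r a b
    by (simp_all add: scaleR_conv_of_real smul_of_real[symmetric] mult.commute)
  show "\<exists>K. \<forall>a b. norm (smul a b) \<le> norm a * norm b * K"
    by (rule exI[of _ 1]) (simp add: norm_smul)
qed (simp_all add: scale_left_distrib scale_right_distrib)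

text \<open>
  Coefficients live in a scalar field of class \<open>heine_borel\<close>, which is complete but not syntactically
  of class \<open>banach\<close>, so the comparison test is needed for this sort.
\<close>
lemma summable_comparison_complete:
  fixes f :: "nat \<Rightarrow> 'v::{real_normed_vector,complete_space}"
  assumes m: "summable m" and le: "\<And>j. norm (f j) \<le> m j"
  shows "summable f"
proof -
  have diff: "dist (sum f {..<p}) (sum f {..<q}) \<le> dist (sum m {..<p}) (sum m {..<q})"
    if "p \<le> q" for p q :: nat
  proof -
    have "dist (sum f {..<p}) (sum f {..<q}) = norm (sum f {p..<q})"
      using that by (subst dist_commute) (simp add: dist_norm sum_diff_nat_ivl lessThan_atLeast0)
    also have "\<dots> \<le> sum m {p..<q}"
      using le by (rule sum_norm_le)
    also have "\<dots> \<le> dist (sum m {..<p}) (sum m {..<q})"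
      using that sum_diff_nat_ivl[of 0 p q m] by (simp add: dist_norm lessThan_atLeast0)
    finally show ?thesis .
  qed
  have "dist (sum f {..<p}) (sum f {..<q}) \<le> dist (sum m {..<p}) (sum m {..<q})" for p q :: nat
    using diff[of p q] diff[of q p] by (cases "p \<le> q") (simp_all add: dist_commute)
  moreover have "Cauchy (\<lambda>n. sum m {..<n})"
    using m by (simp add: summable_iff_convergent convergent_Cauchy)
  ultimately have "Cauchy (\<lambda>n. sum f {..<n})"
    unfolding Cauchy_def by (meson le_less_trans)
  then show ?thesis
    by (simp add: summable_iff_convergent Cauchy_convergent)
qed

locale schauder = banach_over smul
  for smul :: "'k::{real_normed_field,heine_borel} \<Rightarrow> 'e::banach \<Rightarrow> 'e" +
  fixes g :: "nat \<Rightarrow> 'e"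
  assumes basis: "schauder_basis smul g"
begin

definition coef :: "'e \<Rightarrow> nat \<Rightarrow> 'k" where
  "coef x = (THE a. (\<lambda>n. smul (a n) (g n)) sums x)"

definition proj :: "nat \<Rightarrow> 'e \<Rightarrow> 'e" where
  "proj n x = (\<Sum>i<n. smul (coef x i) (g i))"

lemma coef_sums: "(\<lambda>n. smul (coef x n) (g n)) sums x"
  unfolding coef_def using basis
  by (intro theI'[of "\<lambda>a. (\<lambda>n. smul (a n) (g n)) sums x"]) (simp add: schauder_basis_def)

lemma coef_eqI: "(\<lambda>n. smul (a n) (g n)) sums x \<Longrightarrow> coef x = a"
  using basis coef_sums[of x] unfolding schauder_basis_def by blast

lemma proj_tendsto: "(\<lambda>n. proj n x) \<longlonglongrightarrow> x"
  using coef_sums[of x] by (simp add: sums_def proj_def)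

lemma coef_diff: "coef (x - y) = (\<lambda>n. coef x n - coef y n)"
  using sums_diff[OF coef_sums[of x] coef_sums[of y]]
  by (intro coef_eqI) (simp add: scale_left_diff_distrib)

lemma coef_scaleR: "coef (r *\<^sub>R x) = (\<lambda>n. of_real r * coef x n)"
  using bounded_linear.sums[OF bounded_linear_scaleR_right[of r] coef_sums[of x]]
  by (intro coef_eqI) (simp flip: scale_scale add: smul_of_real)

lemma proj_diff: "proj n (x - y) = proj n x - proj n y"
  by (simp add: proj_def coef_diff scale_left_diff_distrib sum_subtractf)

lemma proj_scaleR: "proj n (r *\<^sub>R x) = r *\<^sub>R proj n x"
  by (simp add: proj_def coef_scaleR scaleR_sum_right smul_of_real flip: scale_scale)

lemma proj_0: "proj n 0 = 0"
  using proj_diff[of n 0 0] by simp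

lemma g_nonzero: "g i \<noteq> 0"
proof
  assume "g i = 0"
  have "coef 0 = (\<lambda>n. 0)"
    by (rule coef_eqI) simp
  moreover have "coef 0 = (\<lambda>n. if n = i then 1 else 0)"
  proof (rule coef_eqI)
    have "(\<lambda>n. smul (if n = i then 1 else 0) (g n)) = (\<lambda>n. 0)"
      using \<open>g i = 0\<close> by auto
    then show "(\<lambda>n. smul (if n = i then 1 else 0) (g n)) sums 0"
      by simp
  qed
  ultimately show False
    by (metis zero_neq_one)
qed

lemma norm_le_of_proj_le: "(\<And>n. norm (proj n x) \<le> M) \<Longrightarrow> norm x \<le> M"
  by (rule tendsto_upperbound[OF tendsto_norm[OF proj_tendsto]]) auto

text \<open>
  The sets of vectors whose partial sums are bounded by a natural number cover the space because
  convergent sequences are bounded, so Baire's theorem applies to their closures.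
\<close>
lemma somewhere_dense:
  obtains M x0 \<delta> where "\<delta> > 0" "ball x0 \<delta> \<subseteq> closure {x. \<forall>n. norm (proj n x) \<le> M}"
proof -
  define A where "A = (\<lambda>M::nat. closure {x. \<forall>n. norm (proj n x) \<le> real M})"
  have "x \<in> \<Union>(range A)" for x
  proof -
    have "Bseq (\<lambda>n. proj n x)"
      using proj_tendsto convergentI convergent_imp_Bseq by blast
    then obtain K where "\<And>n. norm (proj n x) \<le> K"
      unfolding Bseq_def by blast
    moreover obtain M :: nat where "K \<le> real M"
      using real_arch_simple by blast
    ultimately have "x \<in> A M"
      unfolding A_def by (intro subsetD[OF closure_subset]) (auto intro: order_trans)
    then show ?thesis
      by blast
  qed
  then have U: "\<Union>(range A) = UNIV"
    by blast
  have "\<exists>M. interior (A M) \<noteq> {}"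
  proof (rule ccontr)
    assume "\<not> ?thesis"
    then have "Met_TC.mtopology interior_of \<Union>(range A) = {}"
      by (intro Met_TC.metric_Baire_category_alt)
         (auto simp: A_def complete_UNIV)
    then show False
      by (simp add: U)
  qed
  then obtain M x0 where "x0 \<in> interior (A M)"
    by blast
  then obtain \<delta> where "\<delta> > 0" "ball x0 \<delta> \<subseteq> A M"
    using mem_interior by blast
  then show ?thesis
    using that unfolding A_def by blast
qed

text \<open>
  Differences of vectors from the somewhere dense set of the previous lemma are dense in a ball around
  \<open>0\<close>; rescaling that ball handles vectors of every size.
\<close>
lemma approximation:
  "\<exists>M\<ge>0. \<forall>x. \<exists>z. norm (x - z) \<le> norm x / 2 \<and> (\<forall>n. norm (proj n z) \<le> M * norm x)"
proof -
  obtain M x0 \<delta> where \<delta>: "\<delta> > 0" and sub: "ball x0 \<delta> \<subseteq> closure {x. \<forall>n. norm (proj n x) \<le> M}"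
    using somewhere_dense .
  have "x0 \<in> closure {x. \<forall>n. norm (proj n x) \<le> M}"
    using \<delta> sub by auto
  then obtain y where "norm (proj 0 y) \<le> M"
    using closure_empty by (cases "{x. \<forall>n. norm (proj n x) \<le> M} = {}") auto
  then have "M \<ge> 0"
    by (rule order_trans[OF norm_ge_zero])
  define t where "t = 2 / \<delta>"
  have t: "t > 0"
    using \<delta> by (simp add: t_def)
  have *: "\<exists>z. norm (x - z) \<le> norm x / 2 \<and> (\<forall>n. norm (proj n z) \<le> (2 * M * t) * norm x)" for x
  proof (cases "x = 0")
    case True
    then show ?thesis
      by (auto intro: exI[of _ 0] simp: proj_0)
  next
    case False
    define s where "s = t * norm x"
    have s: "s > 0"
      using False t by (simp add: s_def)
    define e where "e = norm x / (4 * s)"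
    have e: "e > 0"
      using False s by (simp add: e_def)
    have "norm (x /\<^sub>R s) < \<delta>"
      using False \<delta> by (simp add: s_def t_def)
    then have "x0 + x /\<^sub>R s \<in> ball x0 \<delta>" "x0 \<in> ball x0 \<delta>"
      using \<delta> by (simp_all add: dist_norm)
    then have "x0 + x /\<^sub>R s \<in> closure {x. \<forall>n. norm (proj n x) \<le> M}"
      "x0 \<in> closure {x. \<forall>n. norm (proj n x) \<le> M}"
      using sub by blast+
    then obtain u v where u: "\<And>n. norm (proj n u) \<le> M" "dist u (x0 + x /\<^sub>R s) < e"
      and v: "\<And>n. norm (proj n v) \<le> M" "dist v x0 < e"
      unfolding closure_approachable using e by (metis (mono_tags, lifting) mem_Collect_eq)
    have "x - s *\<^sub>R (u - v) = s *\<^sub>R ((x0 + x /\<^sub>R s - u) + (v - x0))"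
      using s by (simp add: algebra_simps)
    then have "norm (x - s *\<^sub>R (u - v)) = s * norm ((x0 + x /\<^sub>R s - u) + (v - x0))"
      using s by simp
    also have "\<dots> \<le> s * (e + e)"
      using u(2) v(2) s
      by (intro mult_left_mono norm_triangle_mono) (auto simp: dist_norm norm_minus_commute)
    also have "\<dots> = norm x / 2"
      using s by (simp add: e_def)
    finally have 1: "norm (x - s *\<^sub>R (u - v)) \<le> norm x / 2" .
    have "norm (proj n (s *\<^sub>R (u - v))) \<le> 2 * M * t * norm x" for n
    proof -
      have "norm (proj n (s *\<^sub>R (u - v))) = s * norm (proj n u - proj n v)"
        using s by (simp add: proj_scaleR proj_diff)
      also have "\<dots> \<le> s * (M + M)"
        using u(1)[of n] v(1)[of n] s
        by (intro mult_left_mono norm_triangle_le_diff) auto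
      finally show ?thesis
        by (simp add: s_def mult_ac)
    qed
    with 1 show ?thesis
      by blast
  qed
  have "2 * M * t \<ge> 0"
    using t \<open>M \<ge> 0\<close> by simp
  with * show ?thesis
    by blast
qed

text \<open>
  Repeated approximation writes \<open>x\<close> as a series \<open>\<Sum>z\<^sub>j\<close> whose terms have geometrically decreasing
  partial sums. Adding the expansions of the \<open>z\<^sub>j\<close> coefficientwise yields an expansion of \<open>x\<close>, which
  is the expansion of \<open>x\<close> by uniqueness; so the partial sums of \<open>x\<close> inherit the bound.
\<close>
lemma proj_bounded: "\<exists>b\<ge>0. \<forall>n x. norm (proj n x) \<le> b * norm x"
proof -
  obtain M where M: "M \<ge> 0"
    "\<And>x. \<exists>z. norm (x - z) \<le> norm x / 2 \<and> (\<forall>n. norm (proj n z) \<le> M * norm x)"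
    using approximation by blast
  then obtain Z where Z: "\<And>x. norm (x - Z x) \<le> norm x / 2" "\<And>x n. norm (proj n (Z x)) \<le> M * norm x"
    by metis
  have "norm (proj n x) \<le> (2 * M) * norm x" for n x
  proof -
    define X where "X = rec_nat x (\<lambda>_ y. y - Z y)"
    define z where "z = (\<lambda>j. Z (X j))"
    have X0: "X 0 = x" and XS: "X (Suc j) = X j - z j" for j
      by (simp_all add: X_def z_def)
    have X: "norm (X j) \<le> norm x * (1/2) ^ j" for j
    proof (induction j)
      case (Suc j)
      then show ?case
        using Z(1)[of "X j"] by (simp add: XS z_def)
    qed (simp add: X0)
    define m where "m = (\<lambda>j::nat. M * norm x * (1/2) ^ j)"
    have m: "m sums (2 * M * norm x)"
      using sums_mult[OF geometric_sums[of "1/2::real"], of "M * norm x"] by (simp add: m_def mult_ac)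
    have proj_z: "norm (proj k (z j)) \<le> m j" for k j
    proof -
      have "norm (proj k (z j)) \<le> M * norm (X j)"
        using Z(2) by (simp add: z_def)
      also have "\<dots> \<le> M * (norm x * (1/2) ^ j)"
        using X M(1) by (rule mult_left_mono)
      finally show ?thesis
        by (simp add: m_def mult_ac)
    qed
    have z: "norm (z j) \<le> m j" for j
      using proj_z by (rule norm_le_of_proj_le)
    have sum_z: "z sums x"
    proof -
      have "(\<Sum>j<k. z j) = x - X k" for k
        by (induction k) (simp_all add: X0 XS)
      moreover have "X \<longlonglongrightarrow> 0"
      proof (rule Lim_null_comparison)
        show "\<forall>\<^sub>F j in sequentially. norm (X j) \<le> norm x * (1/2) ^ j"
          using X by simp
        show "(\<lambda>j. norm x * (1/2::real) ^ j) \<longlonglongrightarrow> 0"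
          by (intro tendsto_mult_right_zero LIMSEQ_power_zero) simp
      qed
      ultimately show ?thesis
        using tendsto_diff[OF tendsto_const[of x], of X 0] by (simp add: sums_def)
    qed
    \<comment> \<open>A single coefficient is the difference of two consecutive partial sums, divided by \<open>g i\<close>.\<close>
    have sum_coef: "summable (\<lambda>j. coef (z j) i)" for i
    proof (rule summable_comparison_complete)
      show "norm (coef (z j) i) \<le> 2 / norm (g i) * m j" for j
      proof -
        have "norm (coef (z j) i) * norm (g i) = norm (proj (Suc i) (z j) - proj i (z j))"
          by (simp add: proj_def norm_smul)
        also have "\<dots> \<le> m j + m j"
          by (intro norm_triangle_le_diff add_mono proj_z)
        finally show ?thesis
          using g_nonzero[of i] by (simp add: field_simps)
      qed
      show "summable (\<lambda>j. 2 / norm (g i) * m j)"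
        using m by (intro summable_mult) (rule sums_summable)
    qed
    define c where "c = (\<lambda>i. \<Sum>j. coef (z j) i)"
    have sum_proj: "(\<lambda>j. proj k (z j)) sums (\<Sum>i<k. smul (c i) (g i))" for k
      unfolding proj_def
    proof (rule sums_sum)
      fix i
      show "(\<lambda>j. smul (coef (z j) i) (g i)) sums smul (c i) (g i)"
        unfolding c_def
        by (rule bounded_linear.sums[OF bounded_bilinear.bounded_linear_left[OF bounded_bilinear_smul]])
           (rule summable_sums[OF sum_coef])
    qed
    have "coef x = c"
    proof (rule coef_eqI)
      have bd: "norm (proj k (z j) - z j) \<le> 2 * m j" for k j
        using norm_triangle_le_diff[OF add_mono[OF proj_z z], of k j j] by simp
      have sm: "summable (\<lambda>j. 2 * m j)"
        using m by (intro summable_mult) (rule sums_summable)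
      \<comment> \<open>Dominated convergence for series: each term tends to \<open>0\<close> in \<open>k\<close>.\<close>
      have lim: "(\<lambda>k. \<Sum>j. norm (proj k (z j) - z j)) \<longlonglongrightarrow> (\<Sum>j. 0)"
      proof (intro tannerys_theorem[THEN conjunct2, THEN conjunct2])
        show "(\<lambda>k. norm (proj k (z j) - z j)) \<longlonglongrightarrow> 0" for j
          using tendsto_norm[OF tendsto_diff[OF proj_tendsto[of "z j"] tendsto_const[of "z j"]]] by simp
        show "\<forall>\<^sub>F (j, k) in sequentially \<times>\<^sub>F sequentially. norm (norm (proj k (z j) - z j)) \<le> 2 * m j"
          using bd by (intro always_eventually) auto
      qed (use sm in auto)
      have "(\<lambda>k. (\<Sum>i<k. smul (c i) (g i)) - x) \<longlonglongrightarrow> 0"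
      proof (rule Lim_null_comparison[OF always_eventually])
        show "\<forall>k. norm ((\<Sum>i<k. smul (c i) (g i)) - x) \<le> (\<Sum>j. norm (proj k (z j) - z j))"
        proof
          fix k
          have "summable (\<lambda>j. norm (proj k (z j) - z j))"
            using bd by (intro summable_comparison_test[OF _ sm]) auto
          then show "norm ((\<Sum>i<k. smul (c i) (g i)) - x) \<le> (\<Sum>j. norm (proj k (z j) - z j))"
            using sums_unique[OF sums_diff[OF sum_proj[of k] sum_z]] summable_norm by metis
        qed
      qed (use lim in simp)
      then show "(\<lambda>i. smul (c i) (g i)) sums x"
        unfolding sums_def by (rule LIM_zero_cancel)
    qed
    then have "(\<lambda>j. proj n (z j)) sums proj n x"
      using sum_proj[of n] by (simp add: proj_def)
    then have "norm (proj n x) \<le> 2 * M * norm x"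
      using proj_z[of n] m by (metis norm_sums_le)
    then show ?thesis .
  qed
  then show ?thesis
    using M(1) by (intro exI[of _ "2 * M"]) simp
qed

lemma proj_finite_sum:
  assumes "finite S"
  shows "proj n (\<Sum>i\<in>S. smul (a i) (g i)) = (\<Sum>i | i \<in> S \<and> i < n. smul (a i) (g i))"
proof -
  have "(\<lambda>i. smul (if i \<in> S then a i else 0) (g i)) sums
      (\<Sum>i\<in>S. smul (if i \<in> S then a i else 0) (g i))"
    using assms by (intro sums_finite) auto
  then have "coef (\<Sum>i\<in>S. smul (a i) (g i)) = (\<lambda>i. if i \<in> S then a i else 0)"
    by (intro coef_eqI) simp
  moreover have "(\<Sum>i<n. smul (if i \<in> S then a i else 0) (g i)) =
      (\<Sum>i | i \<in> S \<and> i < n. smul (a i) (g i))"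
    by (rule sum.mono_neutral_cong_right) auto
  ultimately show ?thesis
    by (simp add: proj_def)
qed

theorem initial_sums_bounded:
  obtains b where "b \<ge> 0"
    "\<And>S n a. finite S \<Longrightarrow>
      norm (\<Sum>i | i \<in> S \<and> i < n. smul (a i) (g i)) \<le> b * norm (\<Sum>i\<in>S. smul (a i) (g i))"
proof -
  obtain b where "b \<ge> 0" "\<And>n x. norm (proj n x) \<le> b * norm x"
    using proj_bounded by blast
  then show ?thesis
    using that proj_finite_sum by metis
qed

end

section \<open>Uniform right dominance\<close>

lemma C_dominates_iff_finite_sums:
  assumes F: "banach_over smulF" and E: "banach_over smulE"
  shows "C_dominates C smulF f smulE e \<longleftrightarrow>
    (\<forall>S a. finite S \<longrightarrow>
      norm (\<Sum>i\<in>S. smulE (a i) (e i)) \<le> C * norm (\<Sum>i\<in>S. smulF (a i) (f i)))"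
    (is "?L \<longleftrightarrow> ?R")
proof
  interpret F: banach_over smulF by (rule F)
  interpret E: banach_over smulE by (rule E)
  assume L: ?L
  show ?R
  proof (intro allI impI)
    fix S :: "nat set" and a :: "nat \<Rightarrow> 'a"
    assume S: "finite S"
    define a' where "a' = (\<lambda>i. if i \<in> S then a i else 0)"
    have sub: "{n. a' n \<noteq> 0} \<subseteq> S"
      by (auto simp: a'_def)
    have "(\<Sum>i | a' i \<noteq> 0. smulE (a' i) (e i)) = (\<Sum>i\<in>S. smulE (a i) (e i))"
      using sub S by (intro sum.mono_neutral_cong_left) (auto simp: a'_def)
    moreover have "(\<Sum>i | a' i \<noteq> 0. smulF (a' i) (f i)) = (\<Sum>i\<in>S. smulF (a i) (f i))"
      using sub S by (intro sum.mono_neutral_cong_left) (auto simp: a'_def)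
    moreover have "norm (\<Sum>n | a' n \<noteq> 0. smulE (a' n) (e n)) \<le>
        C * norm (\<Sum>n | a' n \<noteq> 0. smulF (a' n) (f n))"
      using L finite_subset[OF sub S] unfolding C_dominates_def by blast
    ultimately show "norm (\<Sum>i\<in>S. smulE (a i) (e i)) \<le> C * norm (\<Sum>i\<in>S. smulF (a i) (f i))"
      by simp
  qed
qed (simp add: C_dominates_def)

text \<open>
  Translates a cut of the index set into a cut of the basis, so that tails along a subsequence of the
  basis are images under basis projections.
\<close>
lemma strict_mono_on_upper_set:
  fixes v :: "nat \<Rightarrow> nat"
  assumes S: "finite S" and v: "strict_mono_on S v"
  obtains N where "\<And>i. i \<in> S \<Longrightarrow> n \<le> i \<longleftrightarrow> N \<le> v i"
proof (cases "{i \<in> S. n \<le> i} = {}")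
  case True
  have "v i < Suc (Max (v ` S))" if "i \<in> S" for i
    using S that by (simp add: less_Suc_eq_le)
  then show ?thesis
    using True that[of "Suc (Max (v ` S))"] by fastforce
next
  case False
  define j where "j = Min {i \<in> S. n \<le> i}"
  have j: "j \<in> S" "n \<le> j" "\<And>i. i \<in> S \<Longrightarrow> n \<le> i \<Longrightarrow> j \<le> i"
    using Min_in[of "{i \<in> S. n \<le> i}"] S False by (auto simp: j_def)
  have "n \<le> i \<longleftrightarrow> v j \<le> v i" if "i \<in> S" for i
    using j that strict_mono_on_less_eq[OF v, of j i] by fastforce
  then show ?thesis
    using that by blast
qed

locale right_dominant_basis = schauder smul g
  for smul :: "'k::{real_normed_field,heine_borel} \<Rightarrow> 'e::banach \<Rightarrow> 'e" and g +
  assumes semi: "seminormalized g" and rd: "right_dominant smul g"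
begin

abbreviation comb :: "nat set \<Rightarrow> (nat \<Rightarrow> 'k) \<Rightarrow> (nat \<Rightarrow> nat) \<Rightarrow> 'e" where
  "comb S a v \<equiv> \<Sum>i\<in>S. smul (a i) (g (v i))"

lemma tail_sums_bounded:
  "\<exists>b\<ge>0. \<forall>S n a v. finite S \<longrightarrow> strict_mono_on S v \<longrightarrow>
    norm (comb {i \<in> S. n \<le> i} a v) \<le> b * norm (comb S a v)"
proof -
  obtain b where b: "b \<ge> 0" "\<And>S n a. finite S \<Longrightarrow>
      norm (\<Sum>i | i \<in> S \<and> i < n. smul (a i) (g i)) \<le> b * norm (\<Sum>i\<in>S. smul (a i) (g i))"
    using initial_sums_bounded by blast
  have "norm (comb {i \<in> S. n \<le> i} a v) \<le> (1 + b) * norm (comb S a v)"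
    if S: "finite S" and v: "strict_mono_on S v" for S n a and v :: "nat \<Rightarrow> nat"
  proof -
    obtain N where N: "\<And>i. i \<in> S \<Longrightarrow> n \<le> i \<longleftrightarrow> N \<le> v i"
      using strict_mono_on_upper_set[OF S v, of n] by blast
    have inj: "inj_on v S"
      using v by (rule strict_mono_on_imp_inj_on)
    define a' where "a' = (\<lambda>k. a (inv_into S v k))"
    have re: "comb T a v = (\<Sum>k\<in>v ` T. smul (a' k) (g k))" if "T \<subseteq> S" for T
      using that inj_on_subset[OF inj that] inj
      by (simp add: sum.reindex a'_def subset_iff cong: sum.cong)
    have "v ` {i \<in> S. n \<le> i} = v ` S - {k. k \<in> v ` S \<and> k < N}"
      using N by fastforce
    then have "comb {i \<in> S. n \<le> i} a v =
        (\<Sum>k\<in>v ` S. smul (a' k) (g k)) - (\<Sum>k | k \<in> v ` S \<and> k < N. smul (a' k) (g k))"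
      using S by (subst re) (auto intro!: sum_diff)
    also have "norm \<dots> \<le> norm (\<Sum>k\<in>v ` S. smul (a' k) (g k)) +
        b * norm (\<Sum>k\<in>v ` S. smul (a' k) (g k))"
      using b(2)[of "v ` S" a' N] S by (intro norm_triangle_le_diff add_mono) auto
    finally show ?thesis
      by (simp add: re algebra_simps)
  qed
  then show ?thesis
    using b(1) by (intro exI[of _ "1 + b"]) auto
qed

lemma coefficients_bounded:
  "\<exists>B\<ge>0. \<forall>S a v i. finite S \<longrightarrow> strict_mono_on S v \<longrightarrow> i \<in> S \<longrightarrow>
    norm (a i) \<le> B * norm (comb S a v)"
proof -
  obtain b where b: "b \<ge> 0" "\<And>S n a v. finite S \<Longrightarrow> strict_mono_on S v \<Longrightarrow>
    norm (comb {i \<in> S. n \<le> i} a v) \<le> b * norm (comb S a v)"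
    using tail_sums_bounded by blast
  obtain c where c: "c > 0" "\<And>n. c \<le> norm (g n)"
    using semi unfolding seminormalized_def by blast
  have "norm (a i) \<le> (2 * b / c) * norm (comb S a v)"
    if S: "finite S" and v: "strict_mono_on S v" and i: "i \<in> S" for S a v i
  proof -
    have "{j \<in> S. i \<le> j} = insert i {j \<in> S. Suc i \<le> j}"
      using i by auto
    then have "smul (a i) (g (v i)) = comb {j \<in> S. i \<le> j} a v - comb {j \<in> S. Suc i \<le> j} a v"
      using S by simp
    also have "norm \<dots> \<le> b * norm (comb S a v) + b * norm (comb S a v)"
      by (intro norm_triangle_le_diff add_mono b S v)
    finally have "norm (a i) * norm (g (v i)) \<le> 2 * b * norm (comb S a v)"
      by (simp add: norm_smul)
    then have "norm (a i) * c \<le> 2 * b * norm (comb S a v)"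
      using mult_left_mono[OF c(2)[of "v i"], of "norm (a i)"] by simp
    then show ?thesis
      using c(1) by (simp add: field_simps)
  qed
  then show ?thesis
    using b(1) c(1) by (intro exI[of _ "2 * b / c"]) auto
qed

text \<open>
  Only finitely many indices lie below \<open>p\<close>, and there each term is bounded by the norm of the
  dominating combination; hence a common constant on the indices from \<open>p\<close> on would give a constant
  everywhere. So failure of uniformity is witnessed arbitrarily far out.
\<close>
lemma failure_in_tails:
  assumes fail: "\<not> (\<exists>K\<ge>0. \<forall>F v a. finite F \<longrightarrow> strict_mono_on F v \<longrightarrow> (\<forall>i\<in>F. i \<le> v i) \<longrightarrow>
    norm (comb F a id) \<le> K * norm (comb F a v))"
  shows "\<exists>F v a. finite F \<and> strict_mono_on F v \<and> (\<forall>i\<in>F. i \<le> v i) \<and> (\<forall>i\<in>F. p \<le> i) \<and>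
    norm (comb F a id) > real k * norm (comb F a v)"
proof (rule ccontr)
  assume "\<not> ?thesis"
  then have good: "norm (comb F a id) \<le> real k * norm (comb F a v)"
    if "finite F" "strict_mono_on F v" "\<And>i. i \<in> F \<Longrightarrow> i \<le> v i" "\<And>i. i \<in> F \<Longrightarrow> p \<le> i" for F v a
    using that by (meson linorder_not_le)
  obtain b where b: "b \<ge> 0" "\<And>S n a v. finite S \<Longrightarrow> strict_mono_on S v \<Longrightarrow>
    norm (comb {i \<in> S. n \<le> i} a v) \<le> b * norm (comb S a v)"
    using tail_sums_bounded by blast
  obtain B where B: "B \<ge> 0" "\<And>S a v i. finite S \<Longrightarrow> strict_mono_on S v \<Longrightarrow> i \<in> S \<Longrightarrow>
    norm (a i) \<le> B * norm (comb S a v)"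
    using coefficients_bounded by blast
  obtain D where D: "\<And>n. norm (g n) \<le> D"
    using semi unfolding seminormalized_def by blast
  have D0: "D \<ge> 0"
    using D[of 0] norm_ge_zero order_trans by blast
  define K where "K = real p * (B * D) + real k * b"
  have "K \<ge> 0"
    using B(1) b(1) D0 by (simp add: K_def)
  then obtain F v a where F: "finite F" "strict_mono_on F v" "\<And>i. i \<in> F \<Longrightarrow> i \<le> v i"
    and large: "norm (comb F a id) > K * norm (comb F a v)"
    using fail by (meson linorder_not_le)
  let ?L = "norm (comb F a v)"
  have head: "norm (comb {i \<in> F. i < p} a id) \<le> real p * (B * D) * ?L"
  proof -
    have "norm (comb {i \<in> F. i < p} a id) \<le> (\<Sum>i | i \<in> F \<and> i < p. B * D * ?L)"
    proof (rule sum_norm_le)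
      fix i assume "i \<in> {i. i \<in> F \<and> i < p}"
      then have "norm (a i) * norm (g i) \<le> (B * ?L) * D"
        using F B D B(1) by (intro mult_mono) auto
      then show "norm (smul (a i) (g (id i))) \<le> B * D * ?L"
        by (simp add: norm_smul mult_ac)
    qed
    also have "\<dots> = real (card {i \<in> F. i < p}) * (B * D * ?L)"
      by simp
    also have "\<dots> \<le> real p * (B * D * ?L)"
      using B(1) D0 card_mono[of "{..<p}" "{i \<in> F. i < p}"] by (intro mult_right_mono) auto
    finally show ?thesis
      by (simp add: mult_ac)
  qed
  have tail: "norm (comb {i \<in> F. p \<le> i} a id) \<le> real k * b * ?L"
  proof -
    have "norm (comb {i \<in> F. p \<le> i} a id) \<le> real k * norm (comb {i \<in> F. p \<le> i} a v)"
      using F by (intro good) (auto intro: monotone_on_subset)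
    also have "\<dots> \<le> real k * (b * ?L)"
      using F by (intro mult_left_mono b) auto
    finally show ?thesis
      by (simp add: mult_ac)
  qed
  have "F = {i \<in> F. i < p} \<union> {i \<in> F. p \<le> i}"
    by auto
  then have "comb F a id = comb ({i \<in> F. i < p} \<union> {i \<in> F. p \<le> i}) a id"
    by simp
  also have "\<dots> = comb {i \<in> F. i < p} a id + comb {i \<in> F. p \<le> i} a id"
    using F(1) by (intro sum.union_disjoint) auto
  finally have "norm (comb F a id) \<le> K * ?L"
    using norm_triangle_mono[OF head tail] by (simp add: K_def algebra_simps)
  with large show False
    by simp
qed

text \<open>
  Witnesses for the failure of the constants \<open>0, 1, 2, \<dots>\<close> are chosen so that each lives beyond all
  indices of the previous one, on both sides. Their union is then a single pair of increasing
  sequences to which no constant applies.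
\<close>
lemma uniform_right_dominance_id:
  "\<exists>K\<ge>0. \<forall>F v a. finite F \<longrightarrow> strict_mono_on F v \<longrightarrow> (\<forall>i\<in>F. i \<le> v i) \<longrightarrow>
    norm (comb F a id) \<le> K * norm (comb F a v)"
proof (rule ccontr)
  assume "\<not> ?thesis"
  note fail = failure_in_tails[OF this]
  define Q where "Q = (\<lambda>p k F v a. finite F \<and> strict_mono_on F v \<and> (\<forall>i\<in>F. i \<le> v i) \<and>
    (\<forall>i\<in>F. p \<le> i) \<and> norm (comb F a id) > real k * norm (comb F a v))"
  have "\<exists>F v a. Q p k F v a" for p k
    using fail unfolding Q_def .
  then obtain F V A where "\<And>p k. Q p k (F p k) (V p k) (A p k)"
    by metis
  then have tails:
    "\<And>p k. finite (F p k)" "\<And>p k. strict_mono_on (F p k) (V p k)"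
    "\<And>p k i. i \<in> F p k \<Longrightarrow> i \<le> V p k i" "\<And>p k i. i \<in> F p k \<Longrightarrow> p \<le> i"
    "\<And>p k. norm (comb (F p k) (A p k) id) > real k * norm (comb (F p k) (A p k) (V p k))"
    unfolding Q_def by blast+
  define p where "p = rec_nat 0 (\<lambda>k p. Suc (Max (V p k ` F p k)))"
  define G where "G = (\<lambda>k. F (p k) k)"
  define v where "v = (\<lambda>k. V (p k) k)"
  define a where "a = (\<lambda>k. A (p k) k)"
  have fin: "finite (G k)" and smo: "strict_mono_on (G k) (v k)" for k
    using tails(1,2) by (simp_all add: G_def v_def)
  have le: "i \<le> v k i" and lower: "p k \<le> i" if "i \<in> G k" for i k
    using tails(3,4) that by (simp_all add: G_def v_def)
  have large: "norm (comb (G k) (a k) id) > real k * norm (comb (G k) (a k) (v k))" for k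
    using tails(5)[of k "p k"] by (simp add: G_def v_def a_def)
  have upper: "v k i < p (Suc k)" if "i \<in> G k" for i k
  proof -
    have "p (Suc k) = Suc (Max (v k ` G k))"
      by (simp add: p_def G_def v_def)
    then show ?thesis
      using fin[of k] that by (simp add: less_Suc_eq_le)
  qed
  have ne: "G k \<noteq> {}" for k
    using large[of k] by auto
  have p_Suc: "p k < p (Suc k)" for k
    using ne[of k] lower upper le by (meson ex_in_conv le_less_trans)
  then have p_mono: "strict_mono p"
    by (simp add: strict_mono_Suc_iff)
  have ordered: "v k i < j" if "i \<in> G k" "j \<in> G l" "k < l" for i j k l
  proof -
    have "p (Suc k) \<le> p l"
      using that(3) p_mono by (simp add: strict_mono_less_eq)
    then show ?thesis
      using upper[OF that(1)] lower[OF that(2)] by simp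
  qed
  have unique: "k = l" if "i \<in> G k" "i \<in> G l" for i k l
    using ordered[of i k i l] ordered[of i l i k] le that by (meson leD nat_neq_iff)
  define U where "U = (\<Union>k. G k)"
  have inf: "infinite U"
  proof (unfold infinite_nat_iff_unbounded_le, intro allI)
    fix k
    obtain i where "i \<in> G k"
      using ne by blast
    then have "k \<le> i"
      using lower strict_mono_imp_increasing[OF p_mono] by (meson order_trans)
    then show "\<exists>n\<ge>k. n \<in> U"
      using \<open>i \<in> G k\<close> unfolding U_def by blast
  qed
  define \<phi> where "\<phi> = (\<lambda>i. v (THE k. i \<in> G k) i)"
  have \<phi>: "\<phi> i = v k i" if "i \<in> G k" for i k
  proof -
    have "(THE k. i \<in> G k) = k"
      using unique that by (intro the_equality) blast+
    then show ?thesis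
      by (simp add: \<phi>_def)
  qed
  have \<phi>_mono: "\<phi> i < \<phi> j" if "i \<in> U" "j \<in> U" "i < j" for i j
  proof -
    from that obtain k l where kl: "i \<in> G k" "j \<in> G l"
      unfolding U_def by blast
    consider "k < l" | "k = l" | "l < k"
      by linarith
    then show ?thesis
    proof cases
      case 1
      then show ?thesis
        using ordered[OF kl 1] le[OF kl(2)] kl \<phi> by simp
    next
      case 2
      then show ?thesis
        using smo kl \<phi> that(3) by (simp add: strict_mono_on_def)
    next
      case 3
      then show ?thesis
        using ordered[OF kl(2,1) 3] le[OF kl(2)] that(3) by simp
    qed
  qed
  define m where "m = enumerate U"
  have m: "strict_mono m" "range m = U"
    using inf by (simp_all add: m_def strict_mono_enumerate range_enumerate)
  have mU: "m n \<in> U" for n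
    using m(2) by blast
  have "strict_mono (\<phi> \<circ> m)"
    using \<phi>_mono mU m(1) by (simp add: strict_mono_def)
  moreover have "m n \<le> (\<phi> \<circ> m) n" for n
    using mU[of n] \<phi> le unfolding U_def by auto
  ultimately have "dominates smul (g \<circ> (\<phi> \<circ> m)) smul (g \<circ> m)"
    using rd m(1) unfolding right_dominant_def by blast
  then obtain C where C: "\<And>S a. finite S \<Longrightarrow>
      norm (\<Sum>i\<in>S. smul (a i) ((g \<circ> m) i)) \<le> C * norm (\<Sum>i\<in>S. smul (a i) ((g \<circ> (\<phi> \<circ> m)) i))"
    unfolding dominates_def C_dominates_iff_finite_sums[OF banach_over_axioms banach_over_axioms]
    by blast
  obtain k :: nat where k: "C \<le> real k"
    using real_arch_simple by blast
  define S where "S = m -` G k"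
  have inj: "inj_on m S"
    by (rule strict_mono_imp_inj_on[OF m(1)])
  have mS: "m ` S = G k"
    using m(2) by (auto simp: S_def U_def)
  have "finite S"
    using fin[of k] mS inj finite_image_iff by metis
  then have "norm (\<Sum>i\<in>S. smul (a k (m i)) (g (m i))) \<le>
      C * norm (\<Sum>i\<in>S. smul (a k (m i)) (g (\<phi> (m i))))"
    using C[of S "a k \<circ> m"] by simp
  moreover have "(\<Sum>i\<in>S. smul (a k (m i)) (g (m i))) = comb (G k) (a k) id"
    using inj by (simp add: sum.reindex flip: mS)
  moreover have "(\<Sum>i\<in>S. smul (a k (m i)) (g (\<phi> (m i)))) = comb (G k) (a k) \<phi>"
    using inj by (simp add: sum.reindex flip: mS)
  moreover have "comb (G k) (a k) \<phi> = comb (G k) (a k) (v k)"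
    by (rule sum.cong) (simp_all add: \<phi>)
  ultimately have "norm (comb (G k) (a k) id) \<le> C * norm (comb (G k) (a k) (v k))"
    by simp
  also have "\<dots> \<le> real k * norm (comb (G k) (a k) (v k))"
    using k by (rule mult_right_mono) simp
  finally show False
    using large[of k] by simp
qed

text \<open>Relabelling the indices by the values of \<open>u\<close> reduces the general case to \<open>u = id\<close>.\<close>
theorem uniform_right_dominance:
  "\<exists>K\<ge>0. \<forall>S u v a. finite S \<longrightarrow> strict_mono_on S u \<longrightarrow> strict_mono_on S v \<longrightarrow>
    (\<forall>i\<in>S. u i \<le> v i) \<longrightarrow> norm (comb S a u) \<le> K * norm (comb S a v)"
proof -
  obtain K where K: "K \<ge> 0" "\<And>F v a. finite F \<Longrightarrow> strict_mono_on F v \<Longrightarrow> (\<forall>i\<in>F. i \<le> v i) \<Longrightarrow>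
      norm (comb F a id) \<le> K * norm (comb F a v)"
    using uniform_right_dominance_id by blast
  have "norm (comb S a u) \<le> K * norm (comb S a v)"
    if S: "finite S" and u: "strict_mono_on S u" and v: "strict_mono_on S v"
      and le: "\<And>i. i \<in> S \<Longrightarrow> u i \<le> v i" for S a u and v :: "nat \<Rightarrow> nat"
  proof -
    have inj: "inj_on u S"
      using u by (rule strict_mono_on_imp_inj_on)
    define w where "w = inv_into S u"
    have w: "w (u i) = i" if "i \<in> S" for i
      using that inj by (simp add: w_def)
    have "strict_mono_on (u ` S) (v \<circ> w)"
    proof (rule strict_mono_onI)
      fix x y assume "x \<in> u ` S" "y \<in> u ` S" "x < y"
      then obtain i j where "i \<in> S" "j \<in> S" "x = u i" "y = u j" "u i < u j"
        by blast
      then show "(v \<circ> w) x < (v \<circ> w) y"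
        using strict_mono_on_less[OF u] strict_mono_on_less[OF v] by (simp add: w)
    qed
    then have "norm (comb (u ` S) (a \<circ> w) id) \<le> K * norm (comb (u ` S) (a \<circ> w) (v \<circ> w))"
      using S le by (intro K(2)) (auto simp: w comp_def)
    moreover have "comb (u ` S) (a \<circ> w) id = comb S a u"
      using inj by (simp add: sum.reindex w cong: sum.cong)
    moreover have "comb (u ` S) (a \<circ> w) (v \<circ> w) = comb S a v"
      using inj by (simp add: sum.reindex w cong: sum.cong)
    ultimately show ?thesis
      by simp
  qed
  then show ?thesis
    using K(1) by blast
qed

end

section \<open>Diagonal subsequences\<close>

text \<open>
  \<open>q k\<close> is the diagonal of the compositions \<open>r k\<close>, \<open>r k \<circ> r (k+1)\<close>, \<dots>, started at position \<open>k\<close>.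
  The point of having all the \<open>q k\<close> at once is the recursion: from position \<open>k\<close> on, the diagonal
  \<open>q k\<close> is a subsequence of \<open>r k\<close> along the next diagonal.
\<close>
lemma diagonal_subsequences:
  fixes r :: "nat \<Rightarrow> nat \<Rightarrow> nat"
  assumes r: "\<And>k. strict_mono (r k)"
  obtains q where "\<And>k. strict_mono (q k)" "\<And>k i. k \<le> i \<Longrightarrow> q k i = r k (q (Suc k) i)"
    "\<And>k i. i < k \<Longrightarrow> q k i = i"
proof -
  define c where "c = rec_nat (\<lambda>_ i. i) (\<lambda>_ f k i. r k (f (Suc k) i))"
  have c: "c 0 k i = i" "c (Suc d) k i = r k (c d (Suc k) i)" for d k i
    by (simp_all add: c_def)
  have c_mono: "i < j \<Longrightarrow> c d k i < c d k j" for d k i j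
    using r by (induction d arbitrary: k) (simp_all add: c strict_mono_less)
  have c_ge: "i \<le> c d k i" for d k i
    by (rule strict_mono_imp_increasing) (simp add: strict_mono_def c_mono)
  define q where "q = (\<lambda>k i. c (Suc i - k) k i)"
  have q1: "q k i = r k (q (Suc k) i)" if "k \<le> i" for k i
    using that by (simp add: q_def Suc_diff_le c)
  have q2: "q k i = i" if "i < k" for k i
    using that by (simp add: q_def c)
  have "q k i < q k (Suc i)" for k i
  proof (induction "Suc i - k" arbitrary: k)
    case 0
    then have "q k i = i"
      by (simp add: q2)
    also have "i < q k (Suc i)"
      using c_ge by (simp add: q_def less_eq_Suc_le)
    finally show ?case .
  next
    case (Suc d)
    then have "q (Suc k) i < q (Suc k) (Suc i)"
      by simp
    then show ?case
      using Suc.hyps(2) r by (simp add: q1 strict_mono_less)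
  qed
  then have "strict_mono (q k)" for k
    by (simp add: strict_mono_Suc_iff)
  then show ?thesis
    using that q1 q2 by blast
qed

section \<open>Hereditary domination\<close>

context right_dominant_basis
begin

text \<open>Fixing one uniform constant lets the constants for sums be written down explicitly.\<close>
definition dominance_const :: real where
  "dominance_const = (SOME K. K \<ge> 0 \<and> (\<forall>S u v a. finite S \<longrightarrow> strict_mono_on S u \<longrightarrow> strict_mono_on S v \<longrightarrow>
    (\<forall>i\<in>S. u i \<le> v i) \<longrightarrow> norm (comb S a u) \<le> K * norm (comb S a v)))"

lemma dominance_const_nonneg: "dominance_const \<ge> 0"
  and comb_le: "finite S \<Longrightarrow> strict_mono_on S u \<Longrightarrow> strict_mono_on S v \<Longrightarrow>
    (\<And>i. i \<in> S \<Longrightarrow> u i \<le> v i) \<Longrightarrow> norm (comb S a u) \<le> dominance_const * norm (comb S a v)"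
proof -
  have "\<exists>K. K \<ge> 0 \<and> (\<forall>S u v a. finite S \<longrightarrow> strict_mono_on S u \<longrightarrow> strict_mono_on S v \<longrightarrow>
    (\<forall>i\<in>S. u i \<le> v i) \<longrightarrow> norm (comb S a u) \<le> K * norm (comb S a v))"
    using uniform_right_dominance by simp
  from someI_ex[OF this, folded dominance_const_def]
  show "dominance_const \<ge> 0" "finite S \<Longrightarrow> strict_mono_on S u \<Longrightarrow> strict_mono_on S v \<Longrightarrow>
    (\<And>i. i \<in> S \<Longrightarrow> u i \<le> v i) \<Longrightarrow> norm (comb S a u) \<le> dominance_const * norm (comb S a v)"
    by simp_all
qed

end

locale dominated_sequences =
  E: right_dominant_basis smulE g + X: banach_over smulX
  for smulE :: "'k::{real_normed_field,heine_borel} \<Rightarrow> 'e::banach \<Rightarrow> 'e"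
    and g :: "nat \<Rightarrow> 'e" and smulX :: "'k \<Rightarrow> 'x::banach \<Rightarrow> 'x"
begin

definition dominated :: "real \<Rightarrow> (nat \<Rightarrow> nat) \<Rightarrow> (nat \<Rightarrow> 'x) \<Rightarrow> bool" where
  "dominated C s x \<longleftrightarrow> (\<forall>S a. finite S \<longrightarrow>
    norm (\<Sum>i\<in>S. smulX (a i) (x i)) \<le> C * norm (E.comb S a s))"

definition subseq_dominated :: "real \<Rightarrow> (nat \<Rightarrow> 'x) \<Rightarrow> bool" where
  "subseq_dominated C x \<longleftrightarrow> (\<exists>r s. strict_mono r \<and> strict_mono s \<and> dominated C s (x \<circ> r))"

text \<open>
  \<open>subseq_dominated\<close> is not preserved under subsequences: a sequence may have some well dominated
  subsequences and others with far larger constants. The hereditary version is preserved,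
  which is what makes it compatible with sums.
\<close>
definition hereditarily_dominated :: "real \<Rightarrow> (nat \<Rightarrow> 'x) \<Rightarrow> bool" where
  "hereditarily_dominated C x \<longleftrightarrow> (\<forall>r. strict_mono r \<longrightarrow> subseq_dominated C (x \<circ> r))"

lemma dominated_iff: "dominated C s x \<longleftrightarrow> C_dominates C smulE (g \<circ> s) smulX x"
  by (simp add: dominated_def C_dominates_iff_finite_sums[OF E.banach_over_axioms X.banach_over_axioms])

lemma dominated_mono: "dominated C s x \<Longrightarrow> C \<le> D \<Longrightarrow> dominated D s x"
  unfolding dominated_def by (meson mult_right_mono norm_ge_zero order_trans)

lemma dominated_subseq:
  assumes "dominated C s x" and r: "strict_mono r"
  shows "dominated C (s \<circ> r) (x \<circ> r)"
  unfolding dominated_def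
proof (intro allI impI)
  fix S :: "nat set" and a :: "nat \<Rightarrow> 'k"
  assume S: "finite S"
  have inj: "inj_on r S"
    by (rule strict_mono_imp_inj_on[OF r])
  define w where "w = inv_into S r"
  have w: "w (r i) = i" if "i \<in> S" for i
    using that inj by (simp add: w_def)
  have "norm (\<Sum>j\<in>r ` S. smulX (a (w j)) (x j)) \<le> C * norm (E.comb (r ` S) (a \<circ> w) s)"
    using assms(1) S by (simp add: dominated_def)
  then show "norm (\<Sum>i\<in>S. smulX (a i) ((x \<circ> r) i)) \<le> C * norm (E.comb S a (s \<circ> r))"
    using inj by (simp add: sum.reindex w cong: sum.cong)
qed

lemma dominated_larger_indices:
  assumes "dominated C s x" "C \<ge> 0" "strict_mono s" "strict_mono t" "\<And>i. s i \<le> t i"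
  shows "dominated (E.dominance_const * C) t x"
  unfolding dominated_def
proof (intro allI impI)
  fix S :: "nat set" and a :: "nat \<Rightarrow> 'k"
  assume S: "finite S"
  have "norm (\<Sum>i\<in>S. smulX (a i) (x i)) \<le> C * norm (E.comb S a s)"
    using assms(1) S by (simp add: dominated_def)
  also have "\<dots> \<le> C * (E.dominance_const * norm (E.comb S a t))"
    using assms S by (intro mult_left_mono E.comb_le) (auto intro: monotone_on_subset)
  finally show "norm (\<Sum>i\<in>S. smulX (a i) (x i)) \<le> E.dominance_const * C * norm (E.comb S a t)"
    by (simp add: mult_ac)
qed

lemma dominated_add: "dominated C s x \<Longrightarrow> dominated D s y \<Longrightarrow> dominated (C + D) s (x + y)"
  unfolding dominated_def
  by (auto simp: X.scale_right_distrib sum.distrib distrib_right intro!: norm_triangle_mono)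

lemma dominated_scaleR:
  assumes "dominated C s x"
  shows "dominated (\<bar>t\<bar> * C) s (\<lambda>n. t *\<^sub>R x n)"
  unfolding dominated_def
proof (intro allI impI)
  fix S :: "nat set" and a :: "nat \<Rightarrow> 'k"
  assume S: "finite S"
  have "(\<Sum>i\<in>S. smulX (a i) (t *\<^sub>R x i)) = t *\<^sub>R (\<Sum>i\<in>S. smulX (a i) (x i))"
    by (simp add: X.scale_sum_right mult.commute flip: X.smul_of_real)
  then show "norm (\<Sum>i\<in>S. smulX (a i) (t *\<^sub>R x i)) \<le> \<bar>t\<bar> * C * norm (E.comb S a s)"
    using assms S by (simp add: dominated_def mult.assoc mult_left_mono)
qed

lemma subseq_dominated_subseqD: "subseq_dominated C (x \<circ> r) \<Longrightarrow> strict_mono r \<Longrightarrow> subseq_dominated C x"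
  unfolding subseq_dominated_def by (metis comp_assoc strict_mono_o)

lemma hereditarily_dominated_imp_subseq_dominated:
  "hereditarily_dominated C x \<Longrightarrow> subseq_dominated C x"
  unfolding hereditarily_dominated_def by (metis comp_id strict_mono_id)

lemma hereditarily_dominated_subseq:
  "hereditarily_dominated C x \<Longrightarrow> strict_mono r \<Longrightarrow>
    hereditarily_dominated C (x \<circ> r)"
  unfolding hereditarily_dominated_def by (metis comp_assoc strict_mono_o)

lemma hereditarily_dominated_mono:
  "hereditarily_dominated C x \<Longrightarrow> C \<le> D \<Longrightarrow> hereditarily_dominated D x"
  unfolding hereditarily_dominated_def subseq_dominated_def by (meson dominated_mono)

text \<open>Dropping finitely many terms is itself a passage to a subsequence.\<close>
lemma subseq_dominated_tail:
  assumes "subseq_dominated C x" and eq: "\<And>i. n \<le> i \<Longrightarrow> y i = x i"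
  shows "subseq_dominated C y"
proof -
  obtain r s where r: "strict_mono r" and s: "strict_mono s" and d: "dominated C s (x \<circ> r)"
    using assms(1) unfolding subseq_dominated_def by blast
  have shift: "strict_mono (\<lambda>i. i + n)"
    by (simp add: strict_mono_def)
  have "y \<circ> (r \<circ> (\<lambda>i. i + n)) = x \<circ> r \<circ> (\<lambda>i. i + n)"
  proof
    fix i
    have "n \<le> r (i + n)"
      using strict_mono_imp_increasing[OF r, of "i + n"] by simp
    then show "(y \<circ> (r \<circ> (\<lambda>i. i + n))) i = (x \<circ> r \<circ> (\<lambda>i. i + n)) i"
      by (simp add: eq)
  qed
  then show ?thesis
    unfolding subseq_dominated_def using dominated_subseq[OF d shift] strict_mono_o r s shift by metis
qed

lemma hereditarily_dominated_tail:
  assumes "hereditarily_dominated C x" and eq: "\<And>i. n \<le> i \<Longrightarrow> y i = x i"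
  shows "hereditarily_dominated C y"
  unfolding hereditarily_dominated_def
proof (intro allI impI)
  fix r :: "nat \<Rightarrow> nat"
  assume r: "strict_mono r"
  show "subseq_dominated C (y \<circ> r)"
  proof (rule subseq_dominated_tail[where n = n])
    show "subseq_dominated C (x \<circ> r)"
      using assms(1) r unfolding hereditarily_dominated_def by blast
    show "(y \<circ> r) i = (x \<circ> r) i" if "n \<le> i" for i
      using that strict_mono_imp_increasing[OF r, of i] by (simp add: eq)
  qed
qed

text \<open>
  After passing to a common subsequence the two summands are dominated along different sequences of
  basis indices; their pointwise maximum serves both, by uniform right dominance.
\<close>
lemma hereditarily_dominated_add:
  assumes x: "hereditarily_dominated C x" and y: "hereditarily_dominated D y" and "C \<ge> 0" "D \<ge> 0"
  shows "hereditarily_dominated (E.dominance_const * (C + D)) (x + y)"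
  unfolding hereditarily_dominated_def
proof (intro allI impI)
  fix r :: "nat \<Rightarrow> nat"
  assume r: "strict_mono r"
  obtain r1 s1 where 1: "strict_mono r1" "strict_mono s1" "dominated C s1 (x \<circ> r \<circ> r1)"
    using x r unfolding hereditarily_dominated_def subseq_dominated_def by blast
  obtain r2 s2 where 2: "strict_mono r2" "strict_mono s2" "dominated D s2 (y \<circ> (r \<circ> r1) \<circ> r2)"
    using y strict_mono_o[OF r 1(1)] unfolding hereditarily_dominated_def subseq_dominated_def by blast
  define s where "s = (\<lambda>i. max ((s1 \<circ> r2) i) (s2 i))"
  have s12: "strict_mono (s1 \<circ> r2)"
    using 1 2 strict_mono_o by blast
  then have s: "strict_mono s"
    using 2(2) by (fastforce simp: s_def strict_mono_def less_max_iff_disj)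
  have "dominated (E.dominance_const * C) s (x \<circ> r \<circ> r1 \<circ> r2)"
    using dominated_subseq[OF 1(3) 2(1)] s12 s \<open>C \<ge> 0\<close> by (intro dominated_larger_indices) (auto simp: s_def)
  moreover have "dominated (E.dominance_const * D) s (y \<circ> (r \<circ> r1) \<circ> r2)"
    using 2 s \<open>D \<ge> 0\<close> by (intro dominated_larger_indices[OF 2(3)]) (auto simp: s_def)
  ultimately have "dominated (E.dominance_const * C + E.dominance_const * D) s
      ((x \<circ> r \<circ> r1 \<circ> r2) + (y \<circ> (r \<circ> r1) \<circ> r2))"
    by (rule dominated_add)
  moreover have "(x \<circ> r \<circ> r1 \<circ> r2) + (y \<circ> (r \<circ> r1) \<circ> r2) = (x + y) \<circ> r \<circ> (r1 \<circ> r2)"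
    by auto
  ultimately show "subseq_dominated (E.dominance_const * (C + D)) ((x + y) \<circ> r)"
    unfolding subseq_dominated_def using s strict_mono_o[OF 1(1) 2(1)] by (auto simp: distrib_left)
qed

lemma hereditarily_dominated_scaleR:
  assumes "hereditarily_dominated C x"
  shows "hereditarily_dominated (\<bar>t\<bar> * C) (\<lambda>n. t *\<^sub>R x n)"
  unfolding hereditarily_dominated_def
proof (intro allI impI)
  fix r :: "nat \<Rightarrow> nat"
  assume r: "strict_mono r"
  then obtain r' s where "strict_mono r'" "strict_mono s" "dominated C s (x \<circ> r \<circ> r')"
    using assms unfolding hereditarily_dominated_def subseq_dominated_def by blast
  then show "subseq_dominated (\<bar>t\<bar> * C) ((\<lambda>n. t *\<^sub>R x n) \<circ> r)"
    unfolding subseq_dominated_def using dominated_scaleR[of C s "x \<circ> r \<circ> r'" t] by (auto simp: comp_def)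
qed

text \<open>
  If no constant works hereditarily on any subsequence, then successive subsequences can be chosen
  such that the \<open>n\<close>-th one has no \<open>n\<close>-dominated subsequence at all. Up to finitely many terms the
  diagonal is a subsequence of each of them, so no subsequence of it is dominated with any constant.
\<close>
lemma hereditarily_dominated_subsequence_exists:
  fixes x :: "nat \<Rightarrow> 'x"
  assumes every: "\<And>r. strict_mono r \<Longrightarrow> \<exists>C. subseq_dominated C (x \<circ> r)"
  shows "\<exists>r C. strict_mono r \<and> hereditarily_dominated C (x \<circ> r)"
proof (rule ccontr)
  assume contra: "\<not> ?thesis"
  define sub where "sub = (\<lambda>y :: nat \<Rightarrow> 'x. \<exists>r. strict_mono r \<and> y = x \<circ> r)"
  have bad: "\<exists>r. strict_mono r \<and> \<not> subseq_dominated C (y \<circ> r)" if "sub y" for C y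
  proof -
    from that obtain r where r: "strict_mono r" and y: "y = x \<circ> r"
      unfolding sub_def by blast
    have "\<not> hereditarily_dominated C (x \<circ> r)"
      using contra r by blast
    then show ?thesis
      unfolding hereditarily_dominated_def y by blast
  qed
  define r where "r = (\<lambda>C (y :: nat \<Rightarrow> 'x). SOME r. strict_mono r \<and> \<not> subseq_dominated C (y \<circ> r))"
  have r: "strict_mono (r C y) \<and> \<not> subseq_dominated C (y \<circ> r C y)" if "sub y" for C y
    unfolding r_def using bad[OF that] by (rule someI_ex)
  define y where "y = rec_nat x (\<lambda>n y. y \<circ> r (real n) y)"
  define \<rho> where "\<rho> = (\<lambda>n. r (real n) (y n))"
  have y: "y 0 = x" "y (Suc n) = y n \<circ> \<rho> n" for n
    by (simp_all add: y_def \<rho>_def)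
  have sub: "sub (y n)" for n
  proof (induction n)
    case 0
    show ?case
      unfolding sub_def by (rule exI[of _ id]) (simp add: y strict_mono_id)
  next
    case (Suc n)
    then have "strict_mono (\<rho> n)"
      using r unfolding \<rho>_def by blast
    with Suc show ?case
      unfolding sub_def y by (metis comp_assoc strict_mono_o)
  qed
  have \<rho>: "strict_mono (\<rho> n)" "\<not> subseq_dominated (real n) (y (Suc n))" for n
    using r[of "y n" "real n"] sub[of n] by (simp_all add: y \<rho>_def)
  obtain q where q: "\<And>k. strict_mono (q k)" "\<And>k i. k \<le> i \<Longrightarrow> q k i = \<rho> k (q (Suc k) i)"
    using diagonal_subsequences[of \<rho>] \<rho>(1) by metis
  have tail: "y n (q n i) = x (q 0 i)" if "n \<le> Suc i" for n i
    using that by (induction n) (simp_all add: y flip: q(2))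
  obtain C where C: "subseq_dominated C (x \<circ> q 0)"
    using every q(1) by blast
  obtain n :: nat where n: "C \<le> real n"
    using real_arch_simple by blast
  have "subseq_dominated C (y (Suc n) \<circ> q (Suc n))"
    using C by (rule subseq_dominated_tail[where n = n]) (simp add: tail)
  then have "subseq_dominated C (y (Suc n))"
    using q(1) by (rule subseq_dominated_subseqD)
  then have "subseq_dominated (real n) (y (Suc n))"
    using n unfolding subseq_dominated_def by (meson dominated_mono)
  then show False
    using \<rho>(2) by blast
qed

end

section \<open>Subsequential spaces\<close>

context subsequential_space
begin

lemma R_add: "x \<in> R \<Longrightarrow> y \<in> R \<Longrightarrow> x + y \<in> R"
  and R_smul: "x \<in> R \<Longrightarrow> (\<lambda>n. smul a (x n)) \<in> R"
proof -
  interpret seq: module "\<lambda>a (x :: nat \<Rightarrow> 'x) n. smul a (x n)"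
    by unfold_locales (auto simp: scale_right_distrib scale_left_distrib)
  show "x \<in> R \<Longrightarrow> y \<in> R \<Longrightarrow> x + y \<in> R"
    using R_subspace by (rule seq.subspace_add)
  show "x \<in> R \<Longrightarrow> (\<lambda>n. smul a (x n)) \<in> R"
    using R_subspace by (rule seq.subspace_scale)
qed

lemma R_scaleR: "x \<in> R \<Longrightarrow> (\<lambda>n. t *\<^sub>R x n) \<in> R"
  using R_smul[of x "of_real t"] by (simp add: smul_of_real)

lemma nrm_scaleR: "x \<in> R \<Longrightarrow> nrm (\<lambda>n. t *\<^sub>R x n) = \<bar>t\<bar> * nrm x"
  using nrm_smul[of x "of_real t"] by (simp add: smul_of_real)

lemma R_diff: "x \<in> R \<Longrightarrow> y \<in> R \<Longrightarrow> x - y \<in> R"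
  using R_add[of x "\<lambda>n. (-1) *\<^sub>R y n"] R_scaleR[of y "-1"] by (simp add: plus_fun_def fun_diff_def)

lemma nrm_minus_commute: "x \<in> R \<Longrightarrow> y \<in> R \<Longrightarrow> nrm (x - y) = nrm (y - x)"
  using nrm_scaleR[of "y - x" "-1"] R_diff[of y x] by (simp add: fun_diff_def)

lemma nrm_diff_triangle:
  assumes "x \<in> R" "y \<in> R" "z \<in> R"
  shows "nrm (x - z) \<le> nrm (x - y) + nrm (y - z)"
  using nrm_triangle[OF R_diff[OF assms(1,2)] R_diff[OF assms(2,3)]] by simp

text \<open>
  The unit ball being closed under subsequences extends to all of \<open>R\<close> by scaling.
\<close>
lemma R_subseq: "x \<in> R \<Longrightarrow> strict_mono r \<Longrightarrow> x \<circ> r \<in> R"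
  and nrm_subseq: "x \<in> R \<Longrightarrow> strict_mono r \<Longrightarrow> nrm (x \<circ> r) \<le> nrm x"
proof -
  assume x: "x \<in> R" and r: "strict_mono r"
  have "x \<circ> r \<in> R \<and> nrm (x \<circ> r) \<le> nrm x"
  proof (cases "nrm x = 0")
    case True
    then have "x = 0"
      using nrm_eq_0[OF x] by simp
    then have "x \<circ> r = x"
      by auto
    with x show ?thesis
      by (simp only: order_refl simp_thms)
  next
    case False
    then have pos: "nrm x > 0"
      using nrm_nonneg[OF x] by simp
    define y where "y = (\<lambda>n. inverse (nrm x) *\<^sub>R x n)"
    have "y \<in> unit_ball R nrm"
      using x pos by (simp add: unit_ball_def y_def R_scaleR nrm_scaleR)
    then have y: "y \<circ> r \<in> R" "nrm (y \<circ> r) \<le> 1"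
      using ball_subseq[OF _ r, of y] by (simp_all add: unit_ball_def)
    have "x \<circ> r = (\<lambda>n. nrm x *\<^sub>R (y \<circ> r) n)"
      using pos by (auto simp: y_def)
    then show ?thesis
      using R_scaleR[OF y(1)] nrm_scaleR[OF y(1)] y(2) pos by simp
  qed
  then show "x \<circ> r \<in> R" "nrm (x \<circ> r) \<le> nrm x"
    by auto
qed

lemma norm_le_1: "x \<in> unit_ball R nrm \<Longrightarrow> norm (x i) \<le> 1"
proof -
  assume "x \<in> unit_ball R nrm"
  then have x: "bounded (range x)" "sup_norm x \<le> 1"
    using ball_subset by (auto simp: unit_ball_def ell_infty_def)
  have "bdd_above (range (\<lambda>n. norm (x n)))"
    using x(1) by (auto simp: bounded_iff bdd_above_def)
  then have "norm (x i) \<le> sup_norm x"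
    unfolding sup_norm_def by (rule cSUP_upper[OF UNIV_I])
  with x(2) show ?thesis
    by simp
qed

text \<open>The constant \<open>4/3\<close> is the sum of the geometric series with ratio \<open>1/4\<close>.\<close>
lemma geometric_limit:
  assumes v: "\<And>k. v k \<in> R" and step: "\<And>k. nrm (v (Suc k) - v k) \<le> (1/4) ^ k"
  obtains Y where "Y \<in> R" "\<And>k. nrm (Y - v k) \<le> 4/3 * (1/4) ^ k"
proof -
  have "nrm (v (k + d) - v k) \<le> 4/3 * ((1/4) ^ k - (1/4) ^ (k + d))" for k d
  proof (induction d)
    case 0
    then show ?case
      using nrm_eq_0[of 0] R_diff[OF v[of k] v[of k]] by (simp flip: zero_fun_def)
  next
    case (Suc d)
    have "nrm (v (k + Suc d) - v k) \<le> nrm (v (Suc (k + d)) - v (k + d)) + nrm (v (k + d) - v k)"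
      using nrm_diff_triangle v by simp
    also have "\<dots> \<le> (1/4) ^ (k + d) + 4/3 * ((1/4) ^ k - (1/4) ^ (k + d))"
      using step Suc by (rule add_mono)
    also have "\<dots> = 4/3 * ((1/4) ^ k - (1/4) ^ (k + Suc d))"
      by (simp add: field_simps)
    finally show ?case .
  qed
  note * = this
  have dist: "nrm (v j - v k) \<le> 4/3 * (1/4) ^ k" if "k \<le> j" for j k
  proof -
    have "nrm (v j - v k) \<le> 4/3 * ((1/4) ^ k - (1/4) ^ j)"
      using *[of k "j - k"] that by simp
    also have "\<dots> \<le> 4/3 * (1/4) ^ k"
      by (intro mult_left_mono) auto
    finally show ?thesis .
  qed
  have "\<exists>Y\<in>R. (\<lambda>i. nrm (v i - Y)) \<longlonglongrightarrow> 0"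
  proof (rule nrm_complete)
    show "\<forall>\<epsilon>>0. \<exists>N. \<forall>i\<ge>N. \<forall>j\<ge>N. nrm (v i - v j) < \<epsilon>"
    proof (intro allI impI)
      fix \<epsilon> :: real assume "\<epsilon> > 0"
      then obtain N where N: "(1/4 :: real) ^ N < 3/4 * \<epsilon>"
        using real_arch_pow_inv[of "3/4 * \<epsilon>" "1/4"] by auto
      have "nrm (v i - v j) < \<epsilon>" if "N \<le> j" "j \<le> i" for i j
      proof -
        have "nrm (v i - v j) \<le> 4/3 * (1/4) ^ j"
          using dist that by simp
        also have "\<dots> \<le> 4/3 * (1/4) ^ N"
          using that by (intro mult_left_mono power_decreasing) auto
        finally show ?thesis
          using N by simp
      qed
      then show "\<exists>N. \<forall>i\<ge>N. \<forall>j\<ge>N. nrm (v i - v j) < \<epsilon>"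
        using nrm_minus_commute v by (metis nle_le)
    qed
  qed (use v in auto)
  then obtain Y where Y: "Y \<in> R" and lim: "(\<lambda>i. nrm (v i - Y)) \<longlonglongrightarrow> 0"
    by blast
  have "nrm (Y - v k) \<le> 4/3 * (1/4) ^ k" for k
  proof (rule LIMSEQ_le_const)
    show "(\<lambda>j. nrm (v j - Y) + 4/3 * (1/4) ^ k) \<longlonglongrightarrow> 4/3 * (1/4) ^ k"
      using tendsto_add[OF lim tendsto_const] by simp
    have "nrm (Y - v k) \<le> nrm (v j - Y) + 4/3 * (1/4) ^ k" if "k \<le> j" for j
      using nrm_diff_triangle[OF Y v v, of k j] dist[OF that] nrm_minus_commute[OF Y v, of j]
      by simp
    then show "\<exists>N. \<forall>j\<ge>N. nrm (Y - v k) \<le> nrm (v j - Y) + 4/3 * (1/4) ^ k"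
      by blast
  qed
  then show ?thesis
    using that Y by blast
qed

end

section \<open>Approximation by uniformly dominated sequences\<close>

locale dominated_space =
  E: right_dominant_basis smulE g + X: subsequential_space smulX R nrm
  for smulE :: "'k::{real_normed_field,heine_borel} \<Rightarrow> 'e::banach \<Rightarrow> 'e"
    and g :: "nat \<Rightarrow> 'e" and smulX :: "'k \<Rightarrow> 'x::banach \<Rightarrow> 'x" and R nrm +
  assumes every_dominated: "\<forall>x\<in>R. \<exists>r s. strict_mono r \<and> strict_mono s \<and>
           dominates smulE (g \<circ> s) smulX (x \<circ> r)"
begin

sublocale dominated_sequences smulE g smulX ..

lemma hereditarily_dominated_subsequence:
  assumes "x \<in> R"
  shows "\<exists>r C. strict_mono r \<and> C \<ge> 0 \<and> hereditarily_dominated C (x \<circ> r)"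
proof -
  have "\<exists>C. subseq_dominated C (x \<circ> r)" if r: "strict_mono r" for r
  proof -
    obtain r' s C where "strict_mono r'" "strict_mono s"
        "C_dominates C smulE (g \<circ> s) smulX (x \<circ> r \<circ> r')"
      using every_dominated X.R_subseq[OF assms r] unfolding dominates_def by blast
    then show ?thesis
      unfolding subseq_dominated_def dominated_iff by blast
  qed
  then obtain r C where "strict_mono r" "hereditarily_dominated C (x \<circ> r)"
    using hereditarily_dominated_subsequence_exists by blast
  moreover have "hereditarily_dominated (max C 0) (x \<circ> r)"
    by (rule hereditarily_dominated_mono[OF \<open>hereditarily_dominated C (x \<circ> r)\<close>]) simp
  ultimately show ?thesis
    by (metis max.cobounded2)
qed

text \<open>
  The quantification over a ball of radius \<open>\<rho>\<close> lets badness survive the perturbations of the series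
  construction below, and that over \<open>r\<close> lets it survive later passages to subsequences.
\<close>
definition robustly_bad :: "real \<Rightarrow> real \<Rightarrow> (nat \<Rightarrow> 'x) \<Rightarrow> bool" where
  "robustly_bad C \<rho> y \<longleftrightarrow>
    (\<forall>r z. strict_mono r \<longrightarrow> z \<in> R \<longrightarrow> nrm ((y \<circ> r) - z) \<le> \<rho> \<longrightarrow> \<not> hereditarily_dominated C z)"

text \<open>
  A subsequence of \<open>y\<close> is hereditarily dominated with some constant. Choosing \<open>x\<close> bad for a
  constant much larger than that one, no cancellation against \<open>y\<close> can make \<open>y \<circ> r + \<rho> x\<close> well
  dominated: the difference of a well dominated sequence and a subsequence of \<open>y\<close> would, after division by \<open>\<rho>\<close>,
  be well dominated and near a subsequence of \<open>x\<close>. Leaving the first \<open>n\<close> indices unchanged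
  costs nothing, as hereditary domination ignores finitely many terms, and it makes the diagonal
  recursion hold at every position.
\<close>
lemma robustly_bad_step:
  assumes bad: "\<And>C. C \<ge> 0 \<Longrightarrow> \<exists>x\<in>unit_ball R nrm. robustly_bad C (1/2) x"
    and y: "y \<in> R" and \<rho>: "\<rho> > 0" and C: "C \<ge> 0"
  shows "\<exists>r x. strict_mono r \<and> (\<forall>i<n. r i = i) \<and> x \<in> unit_ball R nrm \<and>
    robustly_bad C (\<rho> / 2) ((y \<circ> r) + (\<lambda>i. \<rho> *\<^sub>R x i))"
proof -
  obtain r0 D where r0: "strict_mono r0" and D: "D \<ge> 0" and h0: "hereditarily_dominated D (y \<circ> r0)"
    using hereditarily_dominated_subsequence[OF y] by blast
  define r where "r = (\<lambda>i. if i < n then i else r0 i)"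
  have r: "strict_mono r"
  proof (rule strict_monoI)
    fix i j :: nat
    assume "i < j"
    then show "r i < r j"
      using strict_mono_imp_increasing[OF r0, of j] strict_mono_less[OF r0, of i j]
      by (auto simp: r_def)
  qed
  have h: "hereditarily_dominated D (y \<circ> r)"
    by (rule hereditarily_dominated_tail[OF h0, of n]) (simp add: r_def)
  define M where "M = (1 / \<rho>) * (E.dominance_const * (C + D))"
  have "M \<ge> 0"
    using \<rho> C D E.dominance_const_nonneg by (simp add: M_def)
  then obtain x where x: "x \<in> unit_ball R nrm" and xb: "robustly_bad M (1/2) x"
    using bad by blast
  have xR: "x \<in> R"
    using x by (simp add: unit_ball_def)
  have "robustly_bad C (\<rho> / 2) ((y \<circ> r) + (\<lambda>i. \<rho> *\<^sub>R x i))"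
    unfolding robustly_bad_def
  proof (intro allI impI notI)
    fix p z
    assume p: "strict_mono p" and z: "z \<in> R"
      and near: "nrm ((((y \<circ> r) + (\<lambda>i. \<rho> *\<^sub>R x i)) \<circ> p) - z) \<le> \<rho> / 2" and hz: "hereditarily_dominated C z"
    have yp: "y \<circ> r \<circ> p \<in> R" "x \<circ> p \<in> R"
      using X.R_subseq y r p xR by blast+
    define z' where "z' = (\<lambda>i. (1 / \<rho>) *\<^sub>R (z i - y (r (p i))))"
    have "hereditarily_dominated D (\<lambda>i. (-1) *\<^sub>R (y \<circ> r \<circ> p) i)"
      using hereditarily_dominated_scaleR[OF hereditarily_dominated_subseq[OF h p], of "-1"] by simp
    then have "hereditarily_dominated (E.dominance_const * (C + D)) (z + (\<lambda>i. (-1) *\<^sub>R (y \<circ> r \<circ> p) i))"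
      using hz C D by (intro hereditarily_dominated_add)
    then have "hereditarily_dominated M z'"
      using hereditarily_dominated_scaleR[of "E.dominance_const * (C + D)" _ "1 / \<rho>"] \<rho> by (fastforce simp: M_def z'_def)
    moreover have z'R: "z' \<in> R"
      using X.R_scaleR[OF X.R_diff[OF z yp(1)], of "1 / \<rho>"] by (simp add: z'_def)
    moreover have "nrm ((x \<circ> p) - z') \<le> 1 / 2"
    proof -
      have "(((y \<circ> r) + (\<lambda>i. \<rho> *\<^sub>R x i)) \<circ> p) - z = (\<lambda>i. \<rho> *\<^sub>R ((x \<circ> p) - z') i)"
        using \<rho> by (auto simp: z'_def algebra_simps)
      then have "\<rho> * nrm ((x \<circ> p) - z') \<le> \<rho> / 2"
        using near X.nrm_scaleR[OF X.R_diff[OF yp(2) z'R], of \<rho>] \<rho> by simp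
      then show ?thesis
        using \<rho> by (simp add: field_simps)
    qed
    ultimately show False
      using xb p unfolding robustly_bad_def by blast
  qed
  then show ?thesis
    using r x by (intro exI[of _ r] exI[of _ x]) (auto simp: r_def)
qed

text \<open>
  Otherwise the step above builds \<open>y\<^sub>n\<^sub>+\<^sub>1 = y\<^sub>n \<circ> r\<^sub>n + 4\<^sup>-\<^sup>n w\<^sub>n\<close> with increasing badness. These sequences
  need not converge, because of the \<open>r\<^sub>n\<close>, but their subsequences \<open>y\<^sub>n \<circ> q\<^sub>n\<close> along the diagonals
  form a Cauchy sequence. No subsequence of the limit is hereditarily dominated, which
  contradicts \<open>hereditarily_dominated_subsequence\<close>.
\<close>
lemma uniform_approximation:
  "\<exists>C\<ge>0. \<forall>x\<in>unit_ball R nrm. \<exists>r z. strict_mono r \<and> z \<in> R \<and>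
    nrm ((x \<circ> r) - z) \<le> 1/2 \<and> hereditarily_dominated C z"
proof (rule ccontr)
  assume "\<not> ?thesis"
  then have bad: "\<exists>x\<in>unit_ball R nrm. robustly_bad C (1/2) x" if "C \<ge> 0" for C
    using that unfolding robustly_bad_def by blast
  define Q where "Q = (\<lambda>n y r x. y \<in> R \<longrightarrow> strict_mono r \<and> (\<forall>i<n. r i = i) \<and> x \<in> unit_ball R nrm \<and>
    robustly_bad (real n) ((1/4) ^ n / 2) ((y \<circ> r) + (\<lambda>i. (1/4) ^ n *\<^sub>R x i)))"
  have "\<exists>r x. Q n y r x" for n y
    using robustly_bad_step[OF bad, of y "(1/4) ^ n" "real n" n] unfolding Q_def by auto
  then obtain r x where Q: "\<And>n y. Q n y (r n y) (x n y)"
    by metis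
  define y where "y = rec_nat 0 (\<lambda>n y. (y \<circ> r n y) + (\<lambda>i. (1/4) ^ n *\<^sub>R x n y i))"
  define \<rho> where "\<rho> = (\<lambda>n. r n (y n))"
  define w where "w = (\<lambda>n. x n (y n))"
  have y0: "y 0 = 0" and yS: "y (Suc n) = (y n \<circ> \<rho> n) + (\<lambda>i. (1/4) ^ n *\<^sub>R w n i)" for n
    by (simp_all add: y_def \<rho>_def w_def)
  have yR: "y n \<in> R" for n
  proof (induction n)
    case 0
    have "(0 :: nat \<Rightarrow> 'x) \<in> c00"
      by (simp add: c00_def)
    then show ?case
      unfolding y0 using X.c00_subset by blast
  next
    case (Suc n)
    then have "strict_mono (\<rho> n)" "w n \<in> R"
      using Q[of n "y n"] by (simp_all add: Q_def \<rho>_def w_def unit_ball_def)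
    then show ?case
      unfolding yS by (intro X.R_add X.R_subseq X.R_scaleR Suc)
  qed
  have \<rho>: "strict_mono (\<rho> n)" "\<And>i. i < n \<Longrightarrow> \<rho> n i = i" and w: "w n \<in> unit_ball R nrm"
    and ybad: "robustly_bad (real n) ((1/4) ^ n / 2) (y (Suc n))" for n
    using Q[of n "y n"] yR[of n] by (simp_all add: Q_def yS \<rho>_def w_def)
  obtain q where q: "\<And>k. strict_mono (q k)" "\<And>k i. k \<le> i \<Longrightarrow> q k i = \<rho> k (q (Suc k) i)"
      "\<And>k i. i < k \<Longrightarrow> q k i = i"
    using diagonal_subsequences[of \<rho>] \<rho>(1) by metis
  have q_eq: "q k i = \<rho> k (q (Suc k) i)" for k i
    using q(2)[of k i] q(3)[of i k] q(3)[of i "Suc k"] \<rho>(2)[of i k] by (cases "k \<le> i") simp_all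
  define v where "v = (\<lambda>n. y n \<circ> q n)"
  have vR: "v n \<in> R" for n
    using X.R_subseq yR q(1) by (simp add: v_def)
  have "nrm (v (Suc n) - v n) \<le> (1/4) ^ n" for n
  proof -
    have "v (Suc n) - v n = (\<lambda>i. (1/4) ^ n *\<^sub>R (w n \<circ> q (Suc n)) i)"
      by (auto simp: v_def yS q_eq[of n])
    moreover have "w n \<circ> q (Suc n) \<in> unit_ball R nrm"
      using w q(1) by (rule X.ball_subseq)
    ultimately show ?thesis
      using X.nrm_scaleR[of "w n \<circ> q (Suc n)" "(1/4) ^ n"] by (simp add: unit_ball_def mult_left_le)
  qed
  from X.geometric_limit[of v, OF vR this]
  obtain Y where Y: "Y \<in> R" "\<And>k. nrm (Y - v k) \<le> 4/3 * (1/4) ^ k"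
    by blast
  obtain t C where t: "strict_mono t" and C: "hereditarily_dominated C (Y \<circ> t)"
    using hereditarily_dominated_subsequence[OF Y(1)] by blast
  obtain n :: nat where n: "C \<le> real n"
    using real_arch_simple by blast
  have "(v (Suc n) \<circ> t) - (Y \<circ> t) = (v (Suc n) - Y) \<circ> t"
    by auto
  then have "nrm ((v (Suc n) \<circ> t) - (Y \<circ> t)) \<le> nrm (v (Suc n) - Y)"
    using X.nrm_subseq[OF X.R_diff[OF vR Y(1)] t] by simp
  also have "\<dots> \<le> 4/3 * (1/4) ^ Suc n"
    unfolding X.nrm_minus_commute[OF vR Y(1)] by (rule Y(2))
  also have "\<dots> \<le> (1/4) ^ n / 2"
    by simp
  finally have "nrm ((y (Suc n) \<circ> (q (Suc n) \<circ> t)) - (Y \<circ> t)) \<le> (1/4) ^ n / 2"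
    by (simp add: v_def comp_assoc)
  moreover have "strict_mono (q (Suc n) \<circ> t)"
    using q(1) t by (rule strict_mono_o)
  ultimately have "\<not> hereditarily_dominated (real n) (Y \<circ> t)"
    using ybad[of n] X.R_subseq[OF Y(1) t] unfolding robustly_bad_def by blast
  then show False
    using hereditarily_dominated_mono[OF C n] by blast
qed

section \<open>Summing the approximations\<close>

text \<open>
  The error of the approximation, multiplied by \<open>2\<close>, lies in the unit ball again, which makes the step
  repeatable.
\<close>
lemma approximation_step:
  "\<exists>C\<ge>0. \<forall>x\<in>unit_ball R nrm. \<exists>r s z w. strict_mono r \<and> strict_mono s \<and>
    w \<in> unit_ball R nrm \<and> dominated C s z \<and> (\<forall>i. x (r i) = z i + (1/2) *\<^sub>R w i)"
proof -
  obtain C where C: "C \<ge> 0" and approx: "\<And>x. x \<in> unit_ball R nrm \<Longrightarrow> \<exists>r z. strict_mono r \<and>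
      z \<in> R \<and> nrm ((x \<circ> r) - z) \<le> 1/2 \<and> hereditarily_dominated C z"
    using uniform_approximation by blast
  have "\<exists>r s z w. strict_mono r \<and> strict_mono s \<and> w \<in> unit_ball R nrm \<and> dominated C s z \<and>
      (\<forall>i. x (r i) = z i + (1/2) *\<^sub>R w i)" if x: "x \<in> unit_ball R nrm" for x
  proof -
    obtain r z where r: "strict_mono r" and z: "z \<in> R" "nrm ((x \<circ> r) - z) \<le> 1/2" "hereditarily_dominated C z"
      using approx[OF x] by blast
    obtain r' s where r': "strict_mono r'" and s: "strict_mono s" "dominated C s (z \<circ> r')"
      using hereditarily_dominated_imp_subseq_dominated[OF z(3)] unfolding subseq_dominated_def by blast
    have xr: "(x \<circ> r) - z \<in> R"
      using x r z(1) by (intro X.R_diff X.R_subseq) (auto simp: unit_ball_def)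
    define w where "w = (\<lambda>i. 2 *\<^sub>R ((x \<circ> r) - z) i)"
    have "w \<in> unit_ball R nrm"
      using X.R_scaleR[OF xr, of 2] X.nrm_scaleR[OF xr, of 2] z(2) by (simp add: unit_ball_def w_def)
    then have "w \<circ> r' \<in> unit_ball R nrm"
      using r' by (rule X.ball_subseq)
    moreover have "strict_mono (r \<circ> r')"
      using r r' by (rule strict_mono_o)
    moreover have "x ((r \<circ> r') i) = (z \<circ> r') i + (1/2) *\<^sub>R (w \<circ> r') i" for i
      by (simp add: w_def)
    ultimately show ?thesis
      using s by blast
  qed
  with C show ?thesis
    by blast
qed

theorem uniform_domination:
  "\<exists>C>0. \<forall>x\<in>unit_ball R nrm. subseq_dominated C x"
proof -
  obtain C where C: "C \<ge> 0" and step: "\<And>x. x \<in> unit_ball R nrm \<Longrightarrow> \<exists>r s z w. strict_mono r \<and>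
      strict_mono s \<and> w \<in> unit_ball R nrm \<and> dominated C s z \<and> (\<forall>i. x (r i) = z i + (1/2) *\<^sub>R w i)"
    using approximation_step by blast
  define Q where "Q = (\<lambda>x r s z w. x \<in> unit_ball R nrm \<longrightarrow> strict_mono r \<and> strict_mono s \<and> w \<in> unit_ball R nrm \<and>
    dominated C s z \<and> (\<forall>i. x (r i) = z i + (1/2) *\<^sub>R w i))"
  have "\<exists>r s z w. Q x r s z w" for x
    using step[of x] unfolding Q_def by auto
  then obtain r0 s0 z0 w0 where Q: "\<And>x. Q x (r0 x) (s0 x) (z0 x) (w0 x)"
    by metis
  obtain b where b: "b \<ge> 0" "\<And>S n a v. finite S \<Longrightarrow> strict_mono_on S v \<Longrightarrow>
    norm (E.comb {i \<in> S. n \<le> i} a v) \<le> b * norm (E.comb S a v)"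
    using E.tail_sums_bounded by blast
  obtain B where B: "B \<ge> 0" "\<And>S a v i. finite S \<Longrightarrow> strict_mono_on S v \<Longrightarrow> i \<in> S \<Longrightarrow>
    norm (a i) \<le> B * norm (E.comb S a v)"
    using E.coefficients_bounded by blast
  define D where "D = 2 * (C * (E.dominance_const * b)) + 2 * B"
  have "D \<ge> 0"
    using C b(1) B(1) E.dominance_const_nonneg by (simp add: D_def)
  have "subseq_dominated D x" if x: "x \<in> unit_ball R nrm" for x
  proof -
    define w where "w = rec_nat x (\<lambda>_. w0)"
    have w0: "w 0 = x"
      by (simp add: w_def)
    have wball: "w k \<in> unit_ball R nrm" for k
    proof (induction k)
      case (Suc k)
      then show ?case
        using Q[of "w k"] by (simp add: w_def Q_def)
    qed (simp add: w_def x)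
    define r s z where "r = (\<lambda>k. r0 (w k))" and "s = (\<lambda>k. s0 (w k))" and "z = (\<lambda>k. z0 (w k))"
    have r: "strict_mono (r k)" and s: "strict_mono (s k)" and z: "dominated C (s k) (z k)"
      and w: "w k (r k i) = z k i + (1/2) *\<^sub>R w (Suc k) i" for k i
      using Q[of "w k"] wball[of k] by (simp_all add: Q_def r_def s_def z_def w_def)
    obtain q where q: "\<And>k. strict_mono (q k)" "\<And>k i. k \<le> i \<Longrightarrow> q k i = r k (q (Suc k) i)"
      using diagonal_subsequences[of r] r by metis
    \<comment> \<open>Only \<open>z j\<close> with \<open>j \<le> i\<close> occur at position \<open>i\<close>, so a finite maximum of indices suffices.\<close>
    define t where "t = (\<lambda>i. Max ((\<lambda>j. s j (q (Suc j) i)) ` {..i}))"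
    have t_ge: "s j (q (Suc j) i) \<le> t i" if "j \<le> i" for i j
      using that by (simp add: t_def)
    have t: "strict_mono t"
    proof (unfold strict_mono_Suc_iff, intro allI)
      fix i
      have "s j (q (Suc j) i) < t (Suc i)" if "j \<le> i" for j
      proof -
        have "s j (q (Suc j) i) < s j (q (Suc j) (Suc i))"
          using s q(1) by (simp add: strict_mono_less)
        also have "\<dots> \<le> t (Suc i)"
          using that by (intro t_ge) simp
        finally show ?thesis .
      qed
      then show "t i < t (Suc i)"
        by (simp add: t_def)
    qed
    \<comment> \<open>The recursion for \<open>q k\<close> at \<open>i\<close> needs \<open>k \<le> i\<close>, so at most \<open>Suc i\<close> terms can be split off.\<close>
    have expand: "x (q 0 i) = (\<Sum>j<k. (1/2) ^ j *\<^sub>R z j (q (Suc j) i)) + (1/2) ^ k *\<^sub>R w k (q k i)"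
      if "k \<le> Suc i" for k i
      using that by (induction k) (simp_all add: w0 q(2) w scaleR_add_right)
    have "dominated D t (x \<circ> q 0)"
      unfolding dominated_def
    proof (intro allI impI)
      fix S :: "nat set" and a :: "nat \<Rightarrow> 'k"
      assume S: "finite S"
      obtain N where N: "\<And>i. i \<in> S \<Longrightarrow> i < N"
        using finite_nat_bounded[OF S] by blast
      let ?L = "norm (E.comb S a t)"
      have tS: "strict_mono_on T t" for T
        using t by (rule monotone_on_subset) simp
      \<comment> \<open>The contribution of \<open>z j\<close>, which is supported on the positions from \<open>j\<close> on.\<close>
      define U where "U = (\<lambda>j. \<Sum>i | i \<in> S \<and> j \<le> i. smulX (a i) (z j (q (Suc j) i)))"
      have U: "norm (U j) \<le> C * (E.dominance_const * b) * ?L" for j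
      proof -
        let ?T = "{i \<in> S. j \<le> i}"
        have sq: "strict_mono (s j \<circ> q (Suc j))"
          using s q(1) by (rule strict_mono_o)
        have "norm (U j) \<le> C * norm (E.comb ?T a (s j \<circ> q (Suc j)))"
          using dominated_subseq[OF z q(1), of j "Suc j"] S unfolding dominated_def U_def by simp
        also have "\<dots> \<le> C * (E.dominance_const * norm (E.comb ?T a t))"
          using S C t_ge by (intro mult_left_mono E.comb_le tS monotone_on_subset[OF sq]) auto
        also have "\<dots> \<le> C * (E.dominance_const * (b * ?L))"
          using S C E.dominance_const_nonneg by (intro mult_left_mono b tS)
        finally show ?thesis
          by (simp add: mult_ac)
      qed
      have "(\<Sum>i\<in>S. smulX (a i) (x (q 0 i))) =
          (\<Sum>i\<in>S. \<Sum>j\<le>i. (1/2) ^ j *\<^sub>R smulX (a i) (z j (q (Suc j) i))) +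
          (\<Sum>i\<in>S. (1/2) ^ Suc i *\<^sub>R smulX (a i) (w (Suc i) (q (Suc i) i)))"
        unfolding sum.distrib[symmetric]
      proof (rule sum.cong)
        fix i
        show "smulX (a i) (x (q 0 i)) =
            (\<Sum>j\<le>i. (1/2) ^ j *\<^sub>R smulX (a i) (z j (q (Suc j) i))) +
            (1/2) ^ Suc i *\<^sub>R smulX (a i) (w (Suc i) (q (Suc i) i))"
          unfolding expand[OF order_refl] X.scale_right_distrib X.scale_sum_right
            lessThan_Suc_atMost
          by (simp add: bounded_bilinear.scaleR_right[OF X.bounded_bilinear_smul])
      qed simp
      also have "(\<Sum>i\<in>S. \<Sum>j\<le>i. (1/2) ^ j *\<^sub>R smulX (a i) (z j (q (Suc j) i))) =
          (\<Sum>i\<in>S. \<Sum>j | j \<in> {..<N} \<and> j \<le> i. (1/2) ^ j *\<^sub>R smulX (a i) (z j (q (Suc j) i)))"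
        using N by (intro sum.cong refl) fastforce+
      also have "\<dots> = (\<Sum>j<N. \<Sum>i | i \<in> S \<and> j \<le> i. (1/2) ^ j *\<^sub>R smulX (a i) (z j (q (Suc j) i)))"
        using S by (intro sum.swap_restrict) auto
      also have "\<dots> = (\<Sum>j<N. (1/2) ^ j *\<^sub>R U j)"
        by (simp add: U_def scaleR_sum_right)
      finally have split: "(\<Sum>i\<in>S. smulX (a i) (x (q 0 i))) = (\<Sum>j<N. (1/2) ^ j *\<^sub>R U j) +
          (\<Sum>i\<in>S. (1/2) ^ Suc i *\<^sub>R smulX (a i) (w (Suc i) (q (Suc i) i)))" .
      have geo: "(\<Sum>j\<in>T. (1/2 :: real) ^ j) \<le> 2" if "finite T" for T
        using sum_le_suminf[of "\<lambda>j. (1/2 :: real) ^ j" T] that by (simp add: suminf_geometric)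
      have "norm (\<Sum>j<N. (1/2) ^ j *\<^sub>R U j) \<le> (\<Sum>j<N. (1/2) ^ j * (C * (E.dominance_const * b) * ?L))"
        using U by (intro sum_norm_le) (simp add: mult_left_mono)
      also have "\<dots> \<le> 2 * (C * (E.dominance_const * b) * ?L)"
        using C b(1) E.dominance_const_nonneg geo by (simp add: mult_right_mono flip: sum_distrib_right)
      finally have 1: "norm (\<Sum>j<N. (1/2) ^ j *\<^sub>R U j) \<le> 2 * (C * (E.dominance_const * b) * ?L)" .
      have "norm (\<Sum>i\<in>S. (1/2) ^ Suc i *\<^sub>R smulX (a i) (w (Suc i) (q (Suc i) i))) \<le>
          (\<Sum>i\<in>S. (1/2) ^ i * (B * ?L))"
      proof (rule sum_norm_le)
        fix i assume i: "i \<in> S"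
        have "norm (a i) * norm (w (Suc i) (q (Suc i) i)) \<le> (B * ?L) * 1"
          using B S i tS X.norm_le_1[OF wball] by (intro mult_mono) auto
        then have "(1/2) ^ Suc i * (norm (a i) * norm (w (Suc i) (q (Suc i) i))) \<le> (1/2) ^ i * (B * ?L)"
          by (intro mult_mono[of "(1/2) ^ Suc i"]) auto
        then show "norm ((1/2) ^ Suc i *\<^sub>R smulX (a i) (w (Suc i) (q (Suc i) i))) \<le>
            (1/2) ^ i * (B * ?L)"
          by (simp add: X.norm_smul)
      qed
      also have "\<dots> \<le> 2 * (B * ?L)"
        using B(1) geo[OF S] by (simp add: mult_right_mono flip: sum_distrib_right)
      finally have 2: "norm (\<Sum>i\<in>S. (1/2) ^ Suc i *\<^sub>R smulX (a i) (w (Suc i) (q (Suc i) i))) \<le>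
          2 * (B * ?L)" .
      show "norm (\<Sum>i\<in>S. smulX (a i) ((x \<circ> q 0) i)) \<le> D * ?L"
        unfolding comp_apply split using norm_triangle_mono[OF 1 2]
        by (simp add: D_def distrib_right mult.assoc)
    qed
    then show ?thesis
      unfolding subseq_dominated_def using t q(1) by blast
  qed
  \<comment> \<open>\<open>D + 1\<close> in place of \<open>D\<close> secures a positive constant.\<close>
  then have "\<forall>x\<in>unit_ball R nrm. subseq_dominated (D + 1) x"
    unfolding subseq_dominated_def by (meson dominated_mono less_add_one less_imp_le)
  then show ?thesis
    using \<open>D \<ge> 0\<close> by (intro exI[of _ "D + 1"]) auto
qed

end

theorem theorem1p3:
  fixes smulE :: "'k::{real_normed_field,heine_borel} \<Rightarrow> 'e::banach \<Rightarrow> 'e"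
    and g :: "nat \<Rightarrow> 'e"
    and smulX :: "'k \<Rightarrow> 'x::banach \<Rightarrow> 'x"
    and R :: "(nat \<Rightarrow> 'x) set"
    and nrm :: "(nat \<Rightarrow> 'x) \<Rightarrow> real"
  assumes "banach_over smulE"
    and "schauder_basis smulE g"
    and "seminormalized g"
    and "right_dominant smulE g"
    and "banach_over smulX"
    and "subsequential_space smulX R nrm"
    and "\<forall>x\<in>R. \<exists>r s. strict_mono r \<and> strict_mono s \<and>
           dominates smulE (g \<circ> s) smulX (x \<circ> r)"
  shows "\<exists>C>0. \<forall>x\<in>unit_ball R nrm. \<exists>r s. strict_mono r \<and> strict_mono s \<and>
           C_dominates C smulE (g \<circ> s) smulX (x \<circ> r)"
proof -
  interpret dominated_space smulE g smulX R nrm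
    by (intro dominated_space.intro right_dominant_basis.intro schauder.intro schauder_axioms.intro
        right_dominant_basis_axioms.intro dominated_space_axioms.intro assms)
  show ?thesis
    using uniform_domination unfolding subseq_dominated_def dominated_iff .
qed

end
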